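(* Consider the problem $\mathrm{Opt}=\min\{g(x): x\in X,\ P(x)\in K\}$ under the standing assumptions in the context, let $\sigma\in(0,1)$, $x^0\in C$, and choose $t_0=\frac{\nu}{\Omega_g}$ and $\eta_0=2\Omega_g$. Then the method $\mathtt{Homotopy}(x^0,\varepsilon,f)$ (defined in the context) finds an $\varepsilon$-solution of the problem, and its total iteration complexity, i.e. the total number $\mathtt{Compl}(x^0,\varepsilon,f)=\sum_{i=0}^{I}R_i$ of conditional gradient iterations, where $R_i$ is the number of iterations performed by the $i$-th call of the inner procedure $\mathtt{CG}$, satisfies $$\mathtt{Compl}(x^0,\varepsilon,f)=\tilde{O}\left(\frac{384\,\Omega_g^2\,\nu}{\varepsilon^2(1-\sigma^2)}+\Omega_g\log\Big(21.2\,\nu\big(1+\tfrac{2}{\varepsilon}\Omega_g\big)\Big)\frac{21.2\,\nu}{\varepsilon}\,\frac{2-\sigma}{1-\sigma}\right),$$ where $\tilde O$ hides polylogarithmic factors in $\varepsilon^{-1}$.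
   Context: **Setting.** $E$ and $H$ are finite-dimensional Euclidean spaces; $E^*$ is the dual of $E$. For a differentiable function $f$, $f'(x)[h]$, $f''(x)[h_1,h_2]$, $f'''(x)[h_1,h_2,h_3]$ denote directional derivatives. For an open convex set $Q$, a function $f$ is self-concordant on $Q$ if it is (convex and) $C^3$ on $Q$ and $|f'''(x)[h,h,h]|\le 2(f''(x)[h,h])^{3/2}$ for all $x\in Q$ and all directions $h$. If $\mathrm{cl}(Q)$ is a closed convex pointed cone, $f$ is a $\nu$-canonical barrier for this cone (written $f\in\mathcal B_\nu$) if it is a self-concordant barrier on $Q$ (value $+\infty$ outside $Q$, tending to $+\infty$ at the boundary of $Q$) and $f(\tau x)=f(x)-\nu\log\tau$ for all $x\in Q$, $\tau>0$. **Standing assumptions.** (1) $g:E\to(-\infty,\infty]$ is proper, closed, convex and continuous on $\mathrm{dom}(g)$, and $\Omega_g:=\max_{x,y\in \mathrm{dom}(g)\cap X}|g(x)-g(y)|$ is finite. (2) $K\subset H$ is a closed convex pointed cone with nonempty interior, with a $\nu$-canonical barrier $f\in\mathcal B_\nu(K)$. (3) $P:E\to H$ is linear, and $F(x):=f(P(x))$ is a $\nu$-canonical barrier on the cone $P^{-1}(K)$; $\mathrm{dom}(F)=\mathrm{int}\,P^{-1}(K)$. (4) $X\subset E$ is nonempty, compact and convex, and $C:=X\cap\mathrm{dom}(F)\cap\mathrm{dom}(g)\ne\emptyset$. An $\varepsilon$-solution is a point $z\in X$ with $P(z)\in K$ and $g(z)-\mathrm{Opt}\le\varepsilon$. **Procedure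 $\mathtt{CG}(x^0,\eta,t)$** ($x^0\in C$, $\eta,t>0$). For $x\in C$ let $s_t(x)$ be any element of $\mathrm{argmin}_{s\in X}\{t^{-1}F'(x)[s]+g(s)\}$ and put $$\mathrm{Gap}_t(x):=t^{-1}F'(x)[x-s_t(x)]+g(x)-g(s_t(x)),\qquad e_t(x):=\big(F''(x)[s_t(x)-x,s_t(x)-x]\big)^{1/2},$$ $$\alpha_t(x):=\min\Big\{1,\frac{t\,\mathrm{Gap}_t(x)}{e_t(x)\,(e_t(x)+t\,\mathrm{Gap}_t(x))}\Big\}$$ (with $\alpha_t(x)=1$ if $e_t(x)=0$). For $k=0,1,\dots$: if $\mathrm{Gap}_t(x^k)>\eta$, set $x^{k+1}=x^k+\alpha_t(x^k)(s_t(x^k)-x^k)$; otherwise stop and return the iteration index $k$ and the point $x^k$. **Method $\mathtt{Homotopy}(x^0,\varepsilon,f)$** (parameters $\varepsilon,\sigma\in(0,1)$, $t_0,\eta_0>0$). Set $x^0_{t_0}=x^0$ and $I=\big\lceil \log(2\eta_0/\varepsilon)/\log(1/\sigma)\big\rceil$. For $i=0,\dots,I-1$: let $\hat x_i$ be the point returned by $\mathtt{CG}(x^0_{t_i},\eta_i,t_i)$, and set $t_{i+1}=t_i/\sigma$, $\eta_{i+1}=\sigma\eta_i$, $x^0_{t_{i+1}}=\hat x_i$. Output $\hat z=\hat x_I$, the point returned by $\mathtt{CG}(x^0_{t_I},\eta_I,t_I)$. $R_i$ is the iteration index returned by the $i$-th call of $\mathtt{CG}$. **Asymptotic notation.** $\tilde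 O$ is understood as $\varepsilon\downarrow 0$, with the problem data, $x^0$ and $\sigma$ fixed; terms that do not grow with $\varepsilon^{-1}$ (such as those depending only on $x^0$ through $F(x^0)$) are absorbed. It is assumed that $\Omega_g>0$, so that $t_0$ is defined. *)

theory Defs
  imports "HOL-Analysis.Analysis" "HOL-Library.Landau_Symbols"
begin

section \<open>Extended-real-valued convex functions\<close>

definition effdom :: "('a \<Rightarrow> ereal) \<Rightarrow> 'a set" where
  "effdom f = {x. f x < \<infinity>}"

definition epi :: "('a \<Rightarrow> ereal) \<Rightarrow> ('a \<times> real) set" where
  "epi f = {(x, r). f x \<le> ereal r}"

definition proper_fun :: "('a \<Rightarrow> ereal) \<Rightarrow> bool" where
  "proper_fun f \<longleftrightarrow> (\<forall>x. f x \<noteq> -\<infinity>) \<and> effdom f \<noteq> {}"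

definition closed_fun :: "('a::topological_space \<Rightarrow> ereal) \<Rightarrow> bool" where
  "closed_fun f \<longleftrightarrow> closed (epi f)"

definition convex_fun :: "('a::real_vector \<Rightarrow> ereal) \<Rightarrow> bool" where
  "convex_fun f \<longleftrightarrow> convex (epi f)"

definition variation :: "('a \<Rightarrow> ereal) \<Rightarrow> 'a set \<Rightarrow> ereal" where
  "variation g X = (SUP p \<in> (effdom g \<inter> X) \<times> (effdom g \<inter> X). \<bar>g (fst p) - g (snd p)\<bar>)"


section \<open>Directional derivatives\<close>

definition D1 :: "('a::real_normed_vector \<Rightarrow> real) \<Rightarrow> 'a \<Rightarrow> 'a \<Rightarrow> real" where
  "D1 f x h = frechet_derivative f (at x) h"

definition D2 :: "('a::real_normed_vector \<Rightarrow> real) \<Rightarrow> 'a \<Rightarrow> 'a \<Rightarrow> 'a \<Rightarrow> real" where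
  "D2 f x h1 h2 = D1 (\<lambda>y. D1 f y h1) x h2"

definition D3 :: "('a::real_normed_vector \<Rightarrow> real) \<Rightarrow> 'a \<Rightarrow> 'a \<Rightarrow> 'a \<Rightarrow> 'a \<Rightarrow> real" where
  "D3 f x h1 h2 h3 = D1 (\<lambda>y. D2 f y h1 h2) x h3"

text \<open>In finite dimension, and for open \<open>Q\<close>, the following is the usual class \<open>C\<^sup>3\<close>.\<close>

definition C3_on :: "'a::euclidean_space set \<Rightarrow> ('a \<Rightarrow> real) \<Rightarrow> bool" where
  "C3_on Q f \<longleftrightarrow>
     (\<forall>x\<in>Q. f differentiable (at x)) \<and>
     (\<forall>h1. \<forall>x\<in>Q. (\<lambda>y. D1 f y h1) differentiable (at x)) \<and>
     (\<forall>h1 h2. \<forall>x\<in>Q. (\<lambda>y. D2 f y h1 h2) differentiable (at x)) \<and>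
     (\<forall>h1 h2 h3. continuous_on Q (\<lambda>x. D3 f x h1 h2 h3))"


section \<open>Self-concordant and canonical barriers\<close>

definition self_concordant_on :: "'a::euclidean_space set \<Rightarrow> ('a \<Rightarrow> real) \<Rightarrow> bool" where
  "self_concordant_on Q f \<longleftrightarrow>
     open Q \<and> convex Q \<and> convex_on Q f \<and> C3_on Q f \<and>
     (\<forall>x\<in>Q. \<forall>h. \<bar>D3 f x h h h\<bar> \<le> 2 * (D2 f x h h) powr (3/2))"

definition self_concordant_barrier :: "'a::euclidean_space set \<Rightarrow> ('a \<Rightarrow> ereal) \<Rightarrow> bool" where
  "self_concordant_barrier Q f \<longleftrightarrow>
     (\<forall>x. f x \<noteq> -\<infinity>) \<and> effdom f = Q \<and>
     self_concordant_on Q (\<lambda>x. real_of_ereal (f x)) \<and>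
     (\<forall>z\<in>frontier Q. (f \<longlongrightarrow> \<infinity>) (at z within Q))"

definition pointed :: "'a::real_vector set \<Rightarrow> bool" where
  "pointed K \<longleftrightarrow> (\<forall>x. x \<in> K \<and> - x \<in> K \<longrightarrow> x = 0)"

text \<open>Pointedness of the cone is kept separate from \<open>canonical_barrier\<close>: the cone
  \<open>P -` K\<close> contains the kernel of \<open>P\<close>, so requiring it to be pointed would force the
  linear map \<open>P\<close> to be injective.\<close>

definition canonical_barrier :: "real \<Rightarrow> 'a::euclidean_space set \<Rightarrow> ('a \<Rightarrow> ereal) \<Rightarrow> bool" where
  "canonical_barrier \<nu> K f \<longleftrightarrow>
     closed K \<and> convex_cone K \<and> self_concordant_barrier (interior K) f \<and>
     (\<forall>x\<in>interior K. \<forall>\<tau>>0. f (\<tau> *\<^sub>R x) = f x - ereal (\<nu> * ln \<tau>))"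


section \<open>The problem\<close>

definition feasible :: "'a set \<Rightarrow> ('a \<Rightarrow> 'b) \<Rightarrow> 'b set \<Rightarrow> 'a set" where
  "feasible X P K = {x \<in> X. P x \<in> K}"

definition Opt :: "('a \<Rightarrow> ereal) \<Rightarrow> 'a set \<Rightarrow> ('a \<Rightarrow> 'b) \<Rightarrow> 'b set \<Rightarrow> ereal" where
  "Opt g X P K = (INF x \<in> feasible X P K. g x)"

definition eps_solution ::
    "('a \<Rightarrow> ereal) \<Rightarrow> 'a set \<Rightarrow> ('a \<Rightarrow> 'b) \<Rightarrow> 'b set \<Rightarrow> real \<Rightarrow> 'a \<Rightarrow> bool" where
  "eps_solution g X P K \<epsilon> z \<longleftrightarrow> z \<in> X \<and> P z \<in> K \<and> g z - Opt g X P K \<le> ereal \<epsilon>"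


section \<open>The conditional gradient procedure\<close>

definition dF :: "('a::euclidean_space \<Rightarrow> ereal) \<Rightarrow> 'a \<Rightarrow> 'a \<Rightarrow> real" where
  "dF F x h = D1 (\<lambda>y. real_of_ereal (F y)) x h"

definition ddF :: "('a::euclidean_space \<Rightarrow> ereal) \<Rightarrow> 'a \<Rightarrow> 'a \<Rightarrow> 'a \<Rightarrow> real" where
  "ddF F x h1 h2 = D2 (\<lambda>y. real_of_ereal (F y)) x h1 h2"

text \<open>The point \<open>s t x\<close> is an arbitrarily chosen minimizer of the subproblem at \<open>x\<close>
  with parameter \<open>t\<close>.\<close>

definition lmo_selection ::
    "('a::euclidean_space \<Rightarrow> ereal) \<Rightarrow> ('a \<Rightarrow> ereal) \<Rightarrow> 'a set \<Rightarrow> (real \<Rightarrow> 'a \<Rightarrow> 'a) \<Rightarrow> bool" where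
  "lmo_selection F g X s \<longleftrightarrow>
     (\<forall>t>0. \<forall>x \<in> X \<inter> effdom F \<inter> effdom g.
        is_arg_min (\<lambda>y. ereal (dF F x y / t) + g y) (\<lambda>y. y \<in> X) (s t x))"

context
  fixes F g :: "'a::euclidean_space \<Rightarrow> ereal" and s :: "real \<Rightarrow> 'a \<Rightarrow> 'a"
begin

definition Gap :: "real \<Rightarrow> 'a \<Rightarrow> real" where
  "Gap t x = dF F x (x - s t x) / t + real_of_ereal (g x) - real_of_ereal (g (s t x))"

definition loc_norm :: "real \<Rightarrow> 'a \<Rightarrow> real" where
  "loc_norm t x = sqrt (ddF F x (s t x - x) (s t x - x))"

definition step_size :: "real \<Rightarrow> 'a \<Rightarrow> real" where
  "step_size t x =
     (let e = loc_norm t x; G = Gap t x in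
      if e = 0 then 1 else min 1 (t * G / (e * (e + t * G))))"

primrec cg_iter :: "real \<Rightarrow> 'a \<Rightarrow> nat \<Rightarrow> 'a" where
  "cg_iter t x0 0 = x0"
| "cg_iter t x0 (Suc k) =
     (let x = cg_iter t x0 k in x + step_size t x *\<^sub>R (s t x - x))"

definition cg_terminates :: "'a \<Rightarrow> real \<Rightarrow> real \<Rightarrow> bool" where
  "cg_terminates x0 \<eta> t \<longleftrightarrow> (\<exists>k. Gap t (cg_iter t x0 k) \<le> \<eta>)"

text \<open>Returned index and point; meaningful only if \<open>cg_terminates x0 \<eta> t\<close>.\<close>

definition cg_index :: "'a \<Rightarrow> real \<Rightarrow> real \<Rightarrow> nat" where
  "cg_index x0 \<eta> t = (LEAST k. Gap t (cg_iter t x0 k) \<le> \<eta>)"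

definition cg_point :: "'a \<Rightarrow> real \<Rightarrow> real \<Rightarrow> 'a" where
  "cg_point x0 \<eta> t = cg_iter t x0 (cg_index x0 \<eta> t)"


section \<open>The homotopy method\<close>

text \<open>The triple of starting point, tolerance and homotopy parameter with which the
  \<open>i\<close>-th call of the inner procedure is made.\<close>

primrec call_args :: "real \<Rightarrow> 'a \<Rightarrow> real \<Rightarrow> real \<Rightarrow> nat \<Rightarrow> 'a \<times> real \<times> real" where
  "call_args \<sigma> x0 \<eta>0 t0 0 = (x0, \<eta>0, t0)"
| "call_args \<sigma> x0 \<eta>0 t0 (Suc i) =
     (case call_args \<sigma> x0 \<eta>0 t0 i of (x, \<eta>, t) \<Rightarrow> (cg_point x \<eta> t, \<sigma> * \<eta>, t / \<sigma>))"

text \<open>If \<open>2 * \<eta>0 < \<epsilon>\<close> the ceiling may be negative; then only call number 0 is made.\<close>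

definition num_stages :: "real \<Rightarrow> real \<Rightarrow> real \<Rightarrow> nat" where
  "num_stages \<sigma> \<eta>0 \<epsilon> = nat \<lceil>ln (2 * \<eta>0 / \<epsilon>) / ln (1 / \<sigma>)\<rceil>"

definition homotopy_terminates :: "real \<Rightarrow> 'a \<Rightarrow> real \<Rightarrow> real \<Rightarrow> real \<Rightarrow> bool" where
  "homotopy_terminates \<sigma> x0 \<eta>0 t0 \<epsilon> \<longleftrightarrow>
     (\<forall>i \<le> num_stages \<sigma> \<eta>0 \<epsilon>. case call_args \<sigma> x0 \<eta>0 t0 i of (x, \<eta>, t) \<Rightarrow> cg_terminates x \<eta> t)"

definition homotopy_output :: "real \<Rightarrow> 'a \<Rightarrow> real \<Rightarrow> real \<Rightarrow> real \<Rightarrow> 'a" where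
  "homotopy_output \<sigma> x0 \<eta>0 t0 \<epsilon> =
     (case call_args \<sigma> x0 \<eta>0 t0 (num_stages \<sigma> \<eta>0 \<epsilon>) of (x, \<eta>, t) \<Rightarrow> cg_point x \<eta> t)"

definition Compl :: "real \<Rightarrow> 'a \<Rightarrow> real \<Rightarrow> real \<Rightarrow> real \<Rightarrow> nat" where
  "Compl \<sigma> x0 \<eta>0 t0 \<epsilon> =
     (\<Sum>i \<le> num_stages \<sigma> \<eta>0 \<epsilon>. case call_args \<sigma> x0 \<eta>0 t0 i of (x, \<eta>, t) \<Rightarrow> cg_index x \<eta> t)"

end


section \<open>Soft-O as the accuracy tends to zero\<close>

definition soft_bigo :: "(real \<Rightarrow> real) \<Rightarrow> (real \<Rightarrow> real) \<Rightarrow> bool" where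
  "soft_bigo u v \<longleftrightarrow> (\<exists>p::nat. u \<in> O[at_right 0](\<lambda>\<epsilon>. v \<epsilon> * ln (1 / \<epsilon>) ^ p))"

end

theory Submission
  imports Defs
begin

text \<open>Put \<open>H t x = F x + t g x\<close>. Since \<open>t\<^sub>i \<eta>\<^sub>i = 2 \<nu>\<close> in every call, each call starts at a point
  that minimizes \<open>H t\<^sub>i\<close> up to a constant \<open>c\<close> not depending on the call: by \<open>F'(x)[x] = - \<nu>\<close> and
  \<open>F'(x)[y] \<le> 0\<close> on the cone, a small gap for \<open>t\<^sub>i\<close> bounds the suboptimality for \<open>t\<^sub>i / \<sigma>\<close>.
  The same two facts turn a small gap into a small value of \<open>g x - Opt\<close>.
  A conditional gradient step decreases \<open>H t\<close> by at least \<open>\<alpha> t Gap / 2\<close>, which is of order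
  \<open>1 / e\<^sup>2\<close>. To bound \<open>e\<close>, note that \<open>s\<close> need not lie in the cone; but \<open>x0\<close> is an interior point, so
  \<open>e\<close> is at most a constant times \<open>- F'(x)[x0]\<close>, and near-minimality of \<open>x\<close> for \<open>H t\<close> forces
  \<open>- F'(x)[x0] \<le> exp (c + 1) (t \<Omega> + \<nu>)\<close>. Thus a call takes \<open>O(t\<^sup>2)\<close> iterations, and the geometric
  sum over the calls is \<open>O(1 / \<epsilon>\<^sup>2)\<close>.\<close>

section \<open>Self-concordant barriers of cones\<close>

text \<open>This says that \<open>1 / sqrt u\<close> is 1-Lipschitz; the product form remains valid where \<open>u\<close>
  vanishes.\<close>

lemma self_concordant_line:
  fixes u u' :: "real \<Rightarrow> real"
  assumes "0 \<le> a"
    and deriv: "\<And>\<tau>. 0 \<le> \<tau> \<Longrightarrow> \<tau> \<le> a \<Longrightarrow> (u has_real_derivative u' \<tau>) (at \<tau>)"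
    and nonneg: "\<And>\<tau>. 0 \<le> \<tau> \<Longrightarrow> \<tau> \<le> a \<Longrightarrow> 0 \<le> u \<tau>"
    and bound: "\<And>\<tau>. 0 \<le> \<tau> \<Longrightarrow> \<tau> \<le> a \<Longrightarrow> \<bar>u' \<tau>\<bar> \<le> 2 * u \<tau> powr (3/2)"
  shows "\<bar>sqrt (u a) - sqrt (u 0)\<bar> \<le> a * sqrt (u 0) * sqrt (u a)"
proof -
  \<comment> \<open>Adding \<open>k > 0\<close> keeps the reciprocal square root differentiable at
    zeros of \<open>u\<close>; letting \<open>k\<close> tend to 0 at the end restores the claim for
    \<open>u\<close> itself.\<close>
  have *: "\<bar>sqrt (u a + k) - sqrt (u 0 + k)\<bar> \<le> a * sqrt (u 0 + k) * sqrt (u a + k)"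
    if "k > 0" for k
  proof -
    define v where "v = (\<lambda>\<tau>. inverse (sqrt (u \<tau> + k)))"
    define v' where "v' = (\<lambda>\<tau>. - (inverse (sqrt (u \<tau> + k)) ^ 2 * (u' \<tau> * (inverse (sqrt (u \<tau> + k)) / 2))))"
    have pos: "u \<tau> + k > 0" if "0 \<le> \<tau>" "\<tau> \<le> a" for \<tau>
      using nonneg[OF that] \<open>k > 0\<close> by simp
    have dv: "(v has_real_derivative v' \<tau>) (at \<tau>)" if "0 \<le> \<tau>" "\<tau> \<le> a" for \<tau>
      unfolding v_def v'_def using pos[OF that]
      by (auto intro!: derivative_eq_intros deriv that simp: power2_eq_square field_simps)
    have vb: "\<bar>v' \<tau>\<bar> \<le> 1" if "0 \<le> \<tau>" "\<tau> \<le> a" for \<tau>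
    proof -
      define w where "w = u \<tau> + k"
      have w: "w > 0" using pos[OF that] by (simp add: w_def)
      have "\<bar>u' \<tau>\<bar> \<le> 2 * u \<tau> powr (3/2)" by (rule bound[OF that])
      also have "\<dots> \<le> 2 * w powr (3/2)"
        using nonneg[OF that] \<open>k > 0\<close> by (simp add: w_def powr_mono2)
      also have "w powr (3/2) = (w powr (1/2)) ^ 3"
        using w by (simp add: powr_powr flip: powr_realpow)
      also have "w powr (1/2) = sqrt w" using w by (simp add: powr_half_sqrt)
      finally have "\<bar>u' \<tau>\<bar> \<le> 2 * sqrt w ^ 3" .
      then show ?thesis
        using w unfolding v'_def w_def[symmetric]
        by (simp add: abs_mult field_simps power2_eq_square power3_eq_cube)
    qed
    have "\<bar>v a - v 0\<bar> \<le> 1 * \<bar>a - 0\<bar>"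
      using field_differentiable_bound[of "{0..a}" v v' 1 a 0] dv vb \<open>0 \<le> a\<close>
      by (auto simp: has_field_derivative_at_within)
    then have "\<bar>v a - v 0\<bar> \<le> a" using \<open>0 \<le> a\<close> by simp
    moreover have "v 0 > 0" "v a > 0" using pos[of 0] pos[of a] \<open>0 \<le> a\<close> by (auto simp: v_def)
    moreover define A B where "A = sqrt (u a + k)" and "B = sqrt (u 0 + k)"
    moreover have "A > 0" "B > 0" using pos[of 0] pos[of a] \<open>0 \<le> a\<close> by (auto simp: A_def B_def)
    moreover have "v a = 1 / A" "v 0 = 1 / B" by (simp_all add: v_def A_def B_def field_simps)
    ultimately have "\<bar>1 / A - 1 / B\<bar> \<le> a" "A > 0" "B > 0" by auto
    then have "\<bar>1 / A - 1 / B\<bar> * (A * B) \<le> a * (A * B)"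
      by (intro mult_right_mono) auto
    moreover have "\<bar>1 / A - 1 / B\<bar> * (A * B) = \<bar>(1 / A - 1 / B) * (A * B)\<bar>"
      using \<open>A > 0\<close> \<open>B > 0\<close> by (simp add: abs_mult)
    moreover have "(1 / A - 1 / B) * (A * B) = B - A"
      using \<open>A > 0\<close> \<open>B > 0\<close> by (simp add: field_simps)
    ultimately show ?thesis
      by (simp add: A_def[symmetric] B_def[symmetric] mult_ac abs_minus_commute)
  qed
  show ?thesis
  proof (rule tendsto_le)
    show "((\<lambda>k. a * sqrt (u 0 + k) * sqrt (u a + k)) \<longlongrightarrow> a * sqrt (u 0) * sqrt (u a)) (at_right 0)"
      by (rule tendsto_eq_intros refl tendsto_ident_at | simp)+
    show "((\<lambda>k. \<bar>sqrt (u a + k) - sqrt (u 0 + k)\<bar>) \<longlongrightarrow> \<bar>sqrt (u a) - sqrt (u 0)\<bar>) (at_right 0)"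
      by (rule tendsto_eq_intros refl tendsto_ident_at | simp)+
    show "eventually (\<lambda>k. \<bar>sqrt (u a + k) - sqrt (u 0 + k)\<bar> \<le> a * sqrt (u 0 + k) * sqrt (u a + k)) (at_right 0)"
      using eventually_at_right_less[of "0::real"] by eventually_elim (rule *)
  qed simp
qed

section \<open>Derivatives along lines and the Hessian as a bilinear form\<close>

lemma D1_line:
  fixes G :: "'a::real_normed_vector \<Rightarrow> real"
  assumes "G differentiable (at (x + \<tau> *\<^sub>R h))"
  shows "((\<lambda>\<tau>. G (x + \<tau> *\<^sub>R h)) has_real_derivative D1 G (x + \<tau> *\<^sub>R h) h) (at \<tau>)"
proof -
  have G: "(G has_derivative D1 G (x + \<tau> *\<^sub>R h)) (at (x + \<tau> *\<^sub>R h))"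
    using assms unfolding frechet_derivative_works D1_def[abs_def] .
  have "((\<lambda>\<tau>. x + \<tau> *\<^sub>R h) has_derivative (\<lambda>r. r *\<^sub>R h)) (at \<tau>)"
    by (auto intro!: derivative_eq_intros)
  from has_derivative_compose[OF this G]
  have "((\<lambda>\<tau>. G (x + \<tau> *\<^sub>R h)) has_derivative (\<lambda>r. D1 G (x + \<tau> *\<^sub>R h) h * r)) (at \<tau>)"
    by (simp add: linear_scale[OF has_derivative_linear[OF G]] mult.commute)
  then show ?thesis
    by (simp add: has_field_derivative_def)
qed

lemma linear_D1:
  "G differentiable (at x) \<Longrightarrow> linear (D1 G x)"
  unfolding D1_def[abs_def] by (rule linear_frechet_derivative)

text \<open>The preimage of a pointed cone under a linear map may contain lines. What survives of
  pointedness is that 0 is not an interior point; it puts 0 on the frontier of a nonempty interior,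
  which forces \<open>\<nu>\<close> to be positive.\<close>

locale canonical =
  fixes \<nu> :: real and K :: "'a::euclidean_space set" and F :: "'a \<Rightarrow> ereal"
  assumes barrier: "canonical_barrier \<nu> K F"
    and zero_notin: "0 \<notin> interior K"
begin

abbreviation Q where "Q \<equiv> interior K"
abbreviation \<phi> where "\<phi> \<equiv> \<lambda>x. real_of_ereal (F x)"

lemma effdom_F: "effdom F = Q"
  and F_not_MInf: "F x \<noteq> -\<infinity>"
  and F_barrier: "z \<in> frontier Q \<Longrightarrow> (F \<longlongrightarrow> \<infinity>) (at z within Q)"
  and sc: "self_concordant_on Q \<phi>"
  and cone_K: "convex_cone K"
  using barrier by (auto simp: canonical_barrier_def self_concordant_barrier_def)

lemma open_Q: "open Q" and convex_Q: "convex Q" and convex_on_Q: "convex_on Q \<phi>"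
  using sc by (auto simp: self_concordant_on_def)

lemma F_eq: "x \<in> Q \<Longrightarrow> F x = ereal (\<phi> x)"
  using effdom_F F_not_MInf[of x] by (cases "F x") (auto simp: effdom_def)

lemma differentiable_F: "x \<in> Q \<Longrightarrow> \<phi> differentiable (at x)"
  and differentiable_dF: "x \<in> Q \<Longrightarrow> (\<lambda>y. dF F y h) differentiable (at x)"
  and differentiable_ddF: "x \<in> Q \<Longrightarrow> (\<lambda>y. ddF F y h1 h2) differentiable (at x)"
  using sc unfolding self_concordant_on_def C3_on_def dF_def ddF_def by blast+

lemma self_concordance: "x \<in> Q \<Longrightarrow> \<bar>D3 \<phi> x h h h\<bar> \<le> 2 * ddF F x h h powr (3/2)"
  using sc unfolding self_concordant_on_def ddF_def by blast

lemma F_line: "x + \<tau> *\<^sub>R h \<in> Q \<Longrightarrow>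
    ((\<lambda>\<tau>. \<phi> (x + \<tau> *\<^sub>R h)) has_real_derivative dF F (x + \<tau> *\<^sub>R h) h) (at \<tau>)"
  using D1_line[OF differentiable_F] by (simp add: dF_def)

lemma dF_line: "x + \<tau> *\<^sub>R h \<in> Q \<Longrightarrow>
    ((\<lambda>\<tau>. dF F (x + \<tau> *\<^sub>R h) h) has_real_derivative ddF F (x + \<tau> *\<^sub>R h) h h) (at \<tau>)"
  using D1_line[OF differentiable_dF] by (simp add: ddF_def D2_def dF_def)

lemma ddF_line: "x + \<tau> *\<^sub>R h \<in> Q \<Longrightarrow>
    ((\<lambda>\<tau>. ddF F (x + \<tau> *\<^sub>R h) h h) has_real_derivative D3 \<phi> (x + \<tau> *\<^sub>R h) h h h) (at \<tau>)"
  using D1_line[OF differentiable_ddF] by (simp add: D3_def ddF_def)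

lemma linear_dF: "x \<in> Q \<Longrightarrow> linear (dF F x)"
  using linear_D1[OF differentiable_F] by (simp add: dF_def[abs_def])

lemma linear_ddF_right: "x \<in> Q \<Longrightarrow> linear (ddF F x h)"
  using linear_D1[OF differentiable_dF] by (simp add: ddF_def[abs_def] D2_def[abs_def] dF_def[abs_def])

text \<open>The first argument of \<open>ddF\<close> is the direction of the inner derivative, so
  additivity in it comes from differentiating \<open>dF F y (a + b) = dF F y a + dF F y b\<close>,
  an identity in \<open>y\<close> on the open set \<open>Q\<close>.\<close>

lemma ddF_add_left:
  assumes "x \<in> Q"
  shows "ddF F x (a + b) h = ddF F x a h + ddF F x b h"
proof -
  have d: "((\<lambda>y. dF F y c) has_derivative ddF F x c) (at x)" for c
    using differentiable_dF[OF assms, of c]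
    unfolding frechet_derivative_works ddF_def[abs_def] D2_def[abs_def] D1_def[abs_def] dF_def[abs_def] .
  have "((\<lambda>y. dF F y (a + b)) has_derivative (\<lambda>h. ddF F x a h + ddF F x b h)) (at x)"
    by (rule has_derivative_transform_within_open[OF has_derivative_add[OF d d] open_Q assms])
      (simp add: linear_add[OF linear_dF])
  from has_derivative_unique[OF this d] show ?thesis by metis
qed

lemma ddF_scale_left:
  assumes "x \<in> Q"
  shows "ddF F x (c *\<^sub>R a) h = c * ddF F x a h"
proof -
  have d: "((\<lambda>y. dF F y c) has_derivative ddF F x c) (at x)" for c
    using differentiable_dF[OF assms, of c]
    unfolding frechet_derivative_works ddF_def[abs_def] D2_def[abs_def] D1_def[abs_def] dF_def[abs_def] .
  have "((\<lambda>y. dF F y (c *\<^sub>R a)) has_derivative (\<lambda>h. c * ddF F x a h)) (at x)"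
    by (rule has_derivative_transform_within_open[OF has_derivative_mult_right[OF d] open_Q assms])
      (simp add: linear_scale[OF linear_dF])
  from has_derivative_unique[OF this d] show ?thesis by metis
qed

lemma ddF_scale: "x \<in> Q \<Longrightarrow> ddF F x (c *\<^sub>R a) (c *\<^sub>R a) = c\<^sup>2 * ddF F x a a"
  by (simp add: ddF_scale_left linear_scale[OF linear_ddF_right] power2_eq_square)

text \<open>The mixed terms \<open>ddF F x a b\<close> and \<open>ddF F x b a\<close> enter the two
  expansions with opposite signs and cancel.\<close>

lemma ddF_parallelogram:
  assumes "x \<in> Q"
  shows "ddF F x (a + b) (a + b) + ddF F x (a - b) (a - b) = 2 * ddF F x a a + 2 * ddF F x b b"
  using ddF_add_left[OF assms, of a "- b"] ddF_scale_left[OF assms, of "- 1" b]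
  by (simp add: ddF_add_left[OF assms] linear_add[OF linear_ddF_right[OF assms]]
      linear_diff[OF linear_ddF_right[OF assms]])

text \<open>Reduction to one variable: on the line through \<open>x\<close> and \<open>y\<close> the
  function \<open>\<phi>\<close> is convex on a connected open set of parameters and lies above its
  tangent at \<open>x\<close>.\<close>

lemma dF_gradient:
  assumes "x \<in> Q" "y \<in> Q"
  shows "dF F x (y - x) \<le> \<phi> y - \<phi> x"
proof -
  let ?h = "y - x" let ?S = "(\<lambda>\<tau>. x + \<tau> *\<^sub>R ?h) -` Q"
  have "open ?S" by (intro open_vimage open_Q continuous_intros)
  have eq: "x + (u * a + v * b) *\<^sub>R ?h = u *\<^sub>R (x + a *\<^sub>R ?h) + v *\<^sub>R (x + b *\<^sub>R ?h)"
    if "u + v = 1" for u v a b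
  proof -
    have "u *\<^sub>R (x + a *\<^sub>R ?h) + v *\<^sub>R (x + b *\<^sub>R ?h) = (u + v) *\<^sub>R x + (u * a + v * b) *\<^sub>R ?h"
      by (simp only: scaleR_add_right scaleR_add_left scaleR_scaleR) (simp only: add_ac)
    then show ?thesis using that by simp
  qed
  have "convex ?S"
    unfolding convex_def
  proof (intro ballI allI impI)
    fix a b u v :: real assume *: "a \<in> ?S" "b \<in> ?S" "0 \<le> u" "0 \<le> v" "u + v = 1"
    then show "u *\<^sub>R a + v *\<^sub>R b \<in> ?S"
      using eq[OF *(5), of a b] convexD[OF convex_Q, of "x + a *\<^sub>R ?h" "x + b *\<^sub>R ?h" u v] by simp
  qed
  then have conv: "convex_on ?S (\<lambda>\<tau>. \<phi> (x + \<tau> *\<^sub>R ?h))"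
    unfolding convex_on_def
  proof (intro conjI ballI allI impI)
    fix a b u v :: real assume *: "a \<in> ?S" "b \<in> ?S" "0 \<le> u" "0 \<le> v" "u + v = 1"
    then show "\<phi> (x + (u *\<^sub>R a + v *\<^sub>R b) *\<^sub>R ?h) \<le> u * \<phi> (x + a *\<^sub>R ?h) + v * \<phi> (x + b *\<^sub>R ?h)"
      using eq[OF *(5), of a b] convex_on_Q unfolding convex_on_def by simp
  qed
  have "connected ?S" using conv by (intro convex_connected) (simp add: convex_on_def)
  have "\<phi> (x + 1 *\<^sub>R ?h) - \<phi> (x + 0 *\<^sub>R ?h) \<ge> dF F (x + 0 *\<^sub>R ?h) ?h * (1 - 0)"
    by (rule convex_on_imp_above_tangent[OF conv \<open>connected ?S\<close>])
      (use assms F_line[of x 0 ?h] \<open>open ?S\<close> in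
        \<open>auto simp: interior_open intro: has_field_derivative_at_within\<close>)
  then show ?thesis by simp
qed

text \<open>Adding the gradient inequalities of two points on a line shows that the slope is
  monotone along it, and \<open>ddF F x h h\<close> is the derivative of that slope.\<close>

lemma ddF_nonneg:
  assumes "x \<in> Q"
  shows "ddF F x h h \<ge> 0"
proof -
  let ?S = "(\<lambda>\<tau>. x + \<tau> *\<^sub>R h) -` Q"
  have "open ?S" by (intro open_vimage open_Q continuous_intros)
  have "mono_on ?S (\<lambda>\<tau>. dF F (x + \<tau> *\<^sub>R h) h)"
  proof (rule mono_onI)
    fix a b :: real assume ab: "a \<in> ?S" "b \<in> ?S" "a \<le> b"
    let ?y = "x + a *\<^sub>R h" and ?z = "x + b *\<^sub>R h"
    have yz: "?z - ?y = (b - a) *\<^sub>R h" "?y - ?z = (a - b) *\<^sub>R h"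
      by (simp_all add: scaleR_left_diff_distrib)
    have "dF F ?y (?z - ?y) + dF F ?z (?y - ?z) \<le> 0"
      using dF_gradient[of ?y ?z] dF_gradient[of ?z ?y] ab by simp
    then have "(b - a) * dF F ?y h + (a - b) * dF F ?z h \<le> 0"
      unfolding yz using ab by (simp add: linear_scale[OF linear_dF])
    then have "(b - a) * (dF F ?z h - dF F ?y h) \<ge> 0"
      by (simp add: algebra_simps)
    then show "dF F (x + a *\<^sub>R h) h \<le> dF F (x + b *\<^sub>R h) h"
      using ab by (cases "a = b") (auto simp: zero_le_mult_iff)
  qed
  moreover have "0 \<in> interior ?S"
    using assms \<open>open ?S\<close> by (simp add: interior_open)
  moreover have "((\<lambda>\<tau>. dF F (x + \<tau> *\<^sub>R h) h) has_real_derivative ddF F x h h) (at 0)"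
    using dF_line[of x 0 h] assms by simp
  ultimately show ?thesis
    using mono_on_imp_deriv_nonneg by blast
qed

section \<open>Variation of the Hessian along segments and the Dikin ellipsoid\<close>

lemma sqrt_ddF_line:
  assumes "0 \<le> a" and seg: "\<And>\<tau>. 0 \<le> \<tau> \<Longrightarrow> \<tau> \<le> a \<Longrightarrow> x + \<tau> *\<^sub>R h \<in> Q"
  shows "\<bar>sqrt (ddF F (x + a *\<^sub>R h) h h) - sqrt (ddF F x h h)\<bar>
           \<le> a * sqrt (ddF F x h h) * sqrt (ddF F (x + a *\<^sub>R h) h h)"
  using self_concordant_line[OF \<open>0 \<le> a\<close>, of "\<lambda>\<tau>. ddF F (x + \<tau> *\<^sub>R h) h h"
      "\<lambda>\<tau>. D3 \<phi> (x + \<tau> *\<^sub>R h) h h h"] ddF_line ddF_nonneg self_concordance seg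
  by simp

text \<open>Self-concordance bounds the Hessian on the segment by
  \<open>p\<^sup>2 / (1 - \<tau> * p)\<^sup>2\<close>. Raising the last exponent to 3 makes the
  double primitive rational, so the remainder contains no logarithm.\<close>

lemma upper_bound_segment:
  assumes "0 \<le> a" and seg: "\<And>\<tau>. 0 \<le> \<tau> \<Longrightarrow> \<tau> \<le> a \<Longrightarrow> x + \<tau> *\<^sub>R h \<in> Q"
  defines "p \<equiv> sqrt (ddF F x h h)"
  assumes r: "a * p < 1"
  shows "\<phi> (x + a *\<^sub>R h) \<le> \<phi> x + a * dF F x h + (a * p)\<^sup>2 / (2 * (1 - a * p))"
proof -
  have xQ: "x \<in> Q" using seg[of 0] \<open>0 \<le> a\<close> by simp
  have p0: "p \<ge> 0" using ddF_nonneg[OF xQ] by (simp add: p_def)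
  have lt: "\<tau> * p < 1" if "\<tau> \<in> {0..a}" for \<tau>
    using mult_right_mono[of \<tau> a p] that p0 r by simp
  \<comment> \<open>The first summand is the double primitive of the enlarged Hessian bound with
    value and slope 0 at 0. Thus \<open>?G\<close> is convex, and its tangent inequality at 0 is the
    claim.\<close>
  let ?G = "\<lambda>\<tau>. (inverse (1 - \<tau> * p) - 1 - \<tau> * p) / 2 - \<phi> (x + \<tau> *\<^sub>R h)"
  let ?G' = "\<lambda>\<tau>. (p * (inverse (1 - \<tau> * p))\<^sup>2 - p) / 2 - dF F (x + \<tau> *\<^sub>R h) h"
  let ?G'' = "\<lambda>\<tau>. p\<^sup>2 * inverse (1 - \<tau> * p) ^ 3 - ddF F (x + \<tau> *\<^sub>R h) h h"
  have "?G' 0 * (a - 0) \<le> ?G a - ?G 0"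
  proof (rule f''_imp_f'[of "{0..a}" ?G ?G' ?G''])
    fix \<tau> assume \<tau>: "\<tau> \<in> {0..a}"
    then have Q: "x + \<tau> *\<^sub>R h \<in> Q" using seg by simp
    have ne: "1 - \<tau> * p \<noteq> 0" using lt[OF \<tau>] by simp
    show "(?G has_real_derivative ?G' \<tau>) (at \<tau>)"
      using ne by (auto intro!: derivative_eq_intros F_line[OF Q] simp: power2_eq_square)
    show "(?G' has_real_derivative ?G'' \<tau>) (at \<tau>)"
      using ne by (auto intro!: derivative_eq_intros dF_line[OF Q] simp: power2_eq_square power3_eq_cube)
    define b where "b = sqrt (ddF F (x + \<tau> *\<^sub>R h) h h)"
    have b0: "b \<ge> 0" using ddF_nonneg[OF Q] by (simp add: b_def)
    have "\<bar>b - p\<bar> \<le> \<tau> * p * b"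
      unfolding b_def p_def using \<tau> by (intro sqrt_ddF_line seg) auto
    then have "b * (1 - \<tau> * p) \<le> p" by (simp add: algebra_simps)
    then have "b \<le> p / (1 - \<tau> * p)" using lt[OF \<tau>] by (simp add: field_simps)
    then have "b\<^sup>2 \<le> p\<^sup>2 / (1 - \<tau> * p)\<^sup>2"
      using power_mono[OF _ b0, of "p / (1 - \<tau> * p)" 2] by (simp add: power_divide)
    also have "\<dots> \<le> p\<^sup>2 / (1 - \<tau> * p) ^ 3"
      using lt[OF \<tau>] p0 \<tau> by (intro divide_left_mono power_decreasing mult_pos_pos) auto
    finally show "0 \<le> ?G'' \<tau>"
      using ddF_nonneg[OF Q] by (simp add: b_def divide_inverse power_inverse)
  qed (use \<open>0 \<le> a\<close> in auto)
  then have "- (a * dF F x h) \<le> (inverse (1 - a * p) - 1 - a * p) / 2 - \<phi> (x + a *\<^sub>R h) + \<phi> x"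
    by (simp add: mult.commute)
  also have "(inverse (1 - a * p) - 1 - a * p) / 2 = (a * p)\<^sup>2 / (2 * (1 - a * p))"
    using r by (simp add: field_simps power2_eq_square)
  finally show ?thesis by simp
qed

text \<open>The open Dikin ellipsoid lies in \<open>Q\<close>: before a first exit from
  \<open>Q\<close> the upper bound keeps \<open>F\<close> bounded on the segment, while the barrier
  property makes it blow up at the exit point.\<close>

lemma ellipsoid_subset:
  assumes "x \<in> Q" "0 \<le> a" and r: "a * sqrt (ddF F x h h) < 1"
  shows "x + a *\<^sub>R h \<in> Q"
proof (rule ccontr)
  assume notin: "x + a *\<^sub>R h \<notin> Q"
  define p where "p = sqrt (ddF F x h h)"
  have p0: "p \<ge> 0" using ddF_nonneg[OF assms(1)] by (simp add: p_def)
  define S where "S = {0..a} \<inter> (\<lambda>\<tau>. x + \<tau> *\<^sub>R h) -` (- Q)"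
  have "closed ((\<lambda>\<tau>. x + \<tau> *\<^sub>R h) -` (- Q))"
    by (intro closed_vimage continuous_intros) (use open_Q in \<open>simp add: closed_def\<close>)
  then have "compact S" unfolding S_def by (intro compact_Int_closed compact_Icc)
  moreover have "a \<in> S" using notin \<open>0 \<le> a\<close> by (simp add: S_def)
  ultimately obtain T where T: "T \<in> S" "\<And>\<tau>. \<tau> \<in> S \<Longrightarrow> T \<le> \<tau>"
    using compact_attains_inf[of S] by auto
  have T0: "0 < T" "T \<le> a" using T(1) \<open>x \<in> Q\<close> by (auto simp: S_def less_le)
  have inQ: "x + \<tau> *\<^sub>R h \<in> Q" if "0 \<le> \<tau>" "\<tau> < T" for \<tau>
    using T(2)[of \<tau>] that T0 by (force simp: S_def)
  define z where "z = x + T *\<^sub>R h"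
  have zQ: "z \<notin> Q" using T(1) by (simp add: S_def z_def)
  have ev: "eventually (\<lambda>\<tau>. 0 < \<tau> \<and> \<tau> < T) (at_left T)"
    using eventually_at_left_real[OF T0(1)] by eventually_elim auto
  have lim: "((\<lambda>\<tau>. x + \<tau> *\<^sub>R h) \<longlongrightarrow> z) (at_left T)"
    unfolding z_def by (intro tendsto_intros)
  have "z \<in> closure Q"
    unfolding closure_sequential
  proof -
    show "\<exists>y. (\<forall>n. y n \<in> Q) \<and> y \<longlonglongrightarrow> z"
    proof (intro exI conjI allI)
      let ?y = "\<lambda>n. x + (T - T / real (Suc n)) *\<^sub>R h"
      show "?y n \<in> Q" for n
        using T0 by (intro inQ) (auto simp: field_simps)
      have "(\<lambda>n. T / real (Suc n)) \<longlonglongrightarrow> 0"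
        using LIMSEQ_Suc[OF lim_const_over_n[of T]] by simp
      then have "?y \<longlonglongrightarrow> x + (T - 0) *\<^sub>R h"
        by (intro tendsto_intros)
      then show "?y \<longlonglongrightarrow> z" by (simp add: z_def)
    qed
  qed
  then have "z \<in> frontier Q" using zQ open_Q by (simp add: frontier_def interior_open)
  have "eventually (\<lambda>\<tau>. x + \<tau> *\<^sub>R h \<in> Q \<and> x + \<tau> *\<^sub>R h \<noteq> z) (at_left T)"
    using ev
  proof eventually_elim
    case (elim \<tau>)
    then have "x + \<tau> *\<^sub>R h \<in> Q" by (intro inQ) auto
    then show ?case using zQ by auto
  qed
  then have "filterlim (\<lambda>\<tau>. x + \<tau> *\<^sub>R h) (at z within Q) (at_left T)"
    using lim by (simp add: filterlim_at)
  from filterlim_compose[OF F_barrier[OF \<open>z \<in> frontier Q\<close>] this]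
  have "((\<lambda>\<tau>. F (x + \<tau> *\<^sub>R h)) \<longlongrightarrow> \<infinity>) (at_left T)" .
  \<comment> \<open>A bound for all \<open>\<tau>\<close> before the exit: the remainder grows with
    \<open>\<tau>\<close>, and the absolute value covers both signs of the slope.\<close>
  moreover define B where "B = \<phi> x + a * \<bar>dF F x h\<bar> + (a * p)\<^sup>2 / (2 * (1 - a * p))"
  ultimately have "eventually (\<lambda>\<tau>. ereal B < F (x + \<tau> *\<^sub>R h)) (at_left T)"
    by (simp add: tendsto_PInfty)
  then have "eventually (\<lambda>\<tau>. False) (at_left T)"
    using ev
  proof eventually_elim
    case (elim \<tau>)
    have le: "\<tau> * p \<le> a * p" using elim T0 p0 by (intro mult_right_mono) auto
    have "\<phi> (x + \<tau> *\<^sub>R h) \<le> \<phi> x + \<tau> * dF F x h + (\<tau> * p)\<^sup>2 / (2 * (1 - \<tau> * p))"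
      using le r elim unfolding p_def by (intro upper_bound_segment inQ) auto
    also have "(\<tau> * p)\<^sup>2 / (2 * (1 - \<tau> * p)) \<le> (a * p)\<^sup>2 / (2 * (1 - a * p))"
      using le r elim p0 unfolding p_def[symmetric] by (intro frac_le power_mono) auto
    also have "\<tau> * dF F x h \<le> a * \<bar>dF F x h\<bar>"
      by (rule order_trans[OF mult_left_mono[OF abs_ge_self] mult_right_mono]) (use elim T0 in auto)
    finally have "\<phi> (x + \<tau> *\<^sub>R h) \<le> B" by (simp add: B_def)
    moreover have "F (x + \<tau> *\<^sub>R h) = ereal (\<phi> (x + \<tau> *\<^sub>R h))" using elim by (intro F_eq inQ) auto
    ultimately show False using elim by (metis ereal_less_eq(3) leD)
  qed
  then show False by simp
qed

lemma upper_bound: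
  assumes "x \<in> Q" "0 \<le> a" and r: "a * sqrt (ddF F x h h) < 1"
  shows "\<phi> (x + a *\<^sub>R h)
    \<le> \<phi> x + a * dF F x h + (a * sqrt (ddF F x h h))\<^sup>2 / (2 * (1 - a * sqrt (ddF F x h h)))"
proof (rule upper_bound_segment[OF \<open>0 \<le> a\<close> _ r])
  fix \<tau> assume "0 \<le> \<tau>" "\<tau> \<le> a"
  then show "x + \<tau> *\<^sub>R h \<in> Q"
    using ellipsoid_subset[OF \<open>x \<in> Q\<close>, of \<tau> h] mult_right_mono[of \<tau> a "sqrt (ddF F x h h)"] r
      ddF_nonneg[OF \<open>x \<in> Q\<close>] by simp
qed

section \<open>Logarithmic homogeneity and slopes in cone directions\<close>

lemma Q_scale: "x \<in> Q \<Longrightarrow> 0 < \<tau> \<Longrightarrow> \<tau> *\<^sub>R x \<in> Q"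
  using interior_maximal[of "(*\<^sub>R) \<tau> ` Q" K] open_scaling[of \<tau> Q] open_Q interior_subset
    convex_cone_scaleR[OF cone_K, of \<tau>] by (auto simp: subset_iff image_iff)

lemma Q_add: 
  assumes "x \<in> Q" "w \<in> K"
  shows "x + w \<in> Q"
proof -
  have "(\<lambda>x. w + x) ` Q \<subseteq> Q"
    using assms(2) interior_subset convex_cone_add[OF cone_K]
    by (intro interior_maximal open_translation open_Q) blast
  then show ?thesis using assms(1) by (auto simp: add.commute)
qed

lemma Q_ray: "x \<in> Q \<Longrightarrow> w \<in> K \<Longrightarrow> 0 \<le> a \<Longrightarrow> x + a *\<^sub>R w \<in> Q"
  by (intro Q_add convex_cone_scaleR[OF cone_K])

lemma \<phi>_scale: "x \<in> Q \<Longrightarrow> 0 < \<tau> \<Longrightarrow> \<phi> (\<tau> *\<^sub>R x) = \<phi> x - \<nu> * ln \<tau>"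
  using barrier F_eq unfolding canonical_barrier_def by (metis ereal_minus(1) real_of_ereal.simps(1))

text \<open>Along the ray through \<open>x\<close> the barrier is
  \<open>\<phi> x - \<nu> * ln \<tau>\<close>. For \<open>\<nu> \<le> 0\<close> it would stay below
  \<open>\<phi> x\<close> as \<open>\<tau>\<close> decreases to 0, although it must tend to infinity
  at the frontier point 0.\<close>

lemma \<nu>_pos:
  assumes "x \<in> Q"
  shows "\<nu> > 0"
proof (rule ccontr)
  assume neg: "\<not> \<nu> > 0"
  have lim: "((\<lambda>\<tau>. \<tau> *\<^sub>R x) \<longlongrightarrow> 0) (at_right 0)"
    by (rule tendsto_eq_intros refl tendsto_ident_at | simp)+
  have ev: "eventually (\<lambda>\<tau>::real. 0 < \<tau> \<and> \<tau> < 1) (at_right 0)"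
    using eventually_at_right_real[of 0 "1::real"] by simp
  then have evQ: "eventually (\<lambda>\<tau>. \<tau> *\<^sub>R x \<in> Q) (at_right 0)"
    by eventually_elim (use Q_scale assms in auto)
  have "0 \<in> closure Q"
    by (rule Lim_in_closed_set[OF closed_closure _ _ lim])
      (use evQ closure_subset in \<open>auto elim!: eventually_mono\<close>)
  then have fr: "0 \<in> frontier Q" using zero_notin open_Q by (simp add: frontier_def interior_open)
  have "filterlim (\<lambda>\<tau>. \<tau> *\<^sub>R x) (at 0 within Q) (at_right 0)"
    unfolding filterlim_at using lim evQ zero_notin by (auto elim!: eventually_mono)
  from filterlim_compose[OF F_barrier[OF fr] this]
  have "eventually (\<lambda>\<tau>. ereal (\<phi> x) < F (\<tau> *\<^sub>R x)) (at_right 0)"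
    by (simp add: tendsto_PInfty)
  then have "eventually (\<lambda>\<tau>::real. False) (at_right 0)"
    using ev
  proof eventually_elim
    case (elim \<tau>)
    have "\<phi> (\<tau> *\<^sub>R x) \<le> \<phi> x"
      using \<phi>_scale[OF assms, of \<tau>] elim neg by (simp add: mult_nonpos_nonpos)
    moreover have "F (\<tau> *\<^sub>R x) = ereal (\<phi> (\<tau> *\<^sub>R x))" using elim assms by (intro F_eq Q_scale) auto
    ultimately show False using elim by (metis ereal_less_eq(3) leD)
  qed
  then show False by simp
qed

text \<open>Euler's identity: differentiate the scaling law at the factor 1.\<close>

lemma dF_self:
  assumes "x \<in> Q"
  shows "dF F x x = - \<nu>"
proof -
  have "((\<lambda>\<tau>. \<phi> (x + \<tau> *\<^sub>R x)) has_real_derivative dF F x x) (at 0)"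
    using F_line[of x 0 x] assms by simp
  moreover have "((\<lambda>\<tau>. \<phi> (x + \<tau> *\<^sub>R x)) has_real_derivative - \<nu>) (at 0)"
  proof (rule has_field_derivative_transform_within_open[where S = "{-1<..}" and f = "\<lambda>\<tau>. \<phi> x - \<nu> * ln (1 + \<tau>)"])
    show "((\<lambda>\<tau>. \<phi> x - \<nu> * ln (1 + \<tau>)) has_real_derivative - \<nu>) (at 0)"
      by (auto intro!: derivative_eq_intros)
    fix \<tau> :: real assume "\<tau> \<in> {-1<..}"
    then show "\<phi> x - \<nu> * ln (1 + \<tau>) = \<phi> (x + \<tau> *\<^sub>R x)"
      using \<phi>_scale[OF assms, of "1 + \<tau>"] by (simp add: scaleR_add_left)
  qed auto
  ultimately show ?thesis by (rule DERIV_unique)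
qed

text \<open>With a positive slope the gradient inequality at \<open>\<tau> *\<^sub>R w\<close> fails
  for large \<open>\<tau>\<close>: its left side grows linearly, its right side decreases
  logarithmically.\<close>

lemma dF_nonpos_interior:
  assumes "x \<in> Q" "w \<in> Q"
  shows "dF F x w \<le> 0"
proof (rule ccontr)
  assume "\<not> dF F x w \<le> 0"
  then have d: "dF F x w > 0" by simp
  have *: "\<tau> * dF F x w \<le> \<phi> w - \<phi> x" if "\<tau> \<ge> 1" for \<tau>
  proof -
    have "dF F x (\<tau> *\<^sub>R w - x) \<le> \<phi> (\<tau> *\<^sub>R w) - \<phi> x"
      using that by (intro dF_gradient Q_scale assms) auto
    then have "\<tau> * dF F x w + \<nu> \<le> \<phi> w - \<nu> * ln \<tau> - \<phi> x"
      using that assms by (simp add: \<phi>_scale linear_diff[OF linear_dF] linear_scale[OF linear_dF] dF_self)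
    moreover have "\<nu> * ln \<tau> \<ge> 0" using that \<nu>_pos[OF assms(1)] by simp
    ultimately show ?thesis using \<nu>_pos[OF assms(1)] by linarith
  qed
  \<comment> \<open>Chosen so that \<open>\<tau> * dF F x w\<close> exceeds
    \<open>\<bar>\<phi> w - \<phi> x\<bar>\<close>.\<close>
  define \<tau> where "\<tau> = 1 + \<bar>\<phi> w - \<phi> x\<bar> / dF F x w"
  have "\<tau> * dF F x w = dF F x w + \<bar>\<phi> w - \<phi> x\<bar>" using d by (simp add: \<tau>_def field_simps)
  moreover have "\<tau> \<ge> 1" using d by (simp add: \<tau>_def)
  ultimately show False using *[of \<tau>] d by linarith
qed

text \<open>Boundary directions are pushed into \<open>Q\<close> by adding
  \<open>(e / \<nu>) *\<^sub>R x\<close>; by \<open>dF_self\<close> this changes the slope by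
  exactly \<open>- e\<close>.\<close>

lemma dF_nonpos:
  assumes "x \<in> Q" "w \<in> K"
  shows "dF F x w \<le> 0"
proof (rule field_le_epsilon)
  fix e :: real assume "e > 0"
  have "w + (e / \<nu>) *\<^sub>R x \<in> Q"
    using Q_add[OF Q_scale[OF assms(1), of "e / \<nu>"] assms(2)] \<open>e > 0\<close> \<nu>_pos[OF assms(1)]
    by (simp add: add.commute)
  then have "dF F x (w + (e / \<nu>) *\<^sub>R x) \<le> 0" by (rule dF_nonpos_interior[OF assms(1)])
  then show "dF F x w \<le> 0 + e"
    using \<nu>_pos[OF assms(1)]
    by (simp add: linear_add[OF linear_dF[OF assms(1)]] linear_scale[OF linear_dF[OF assms(1)]] dF_self[OF assms(1)])
qed

text \<open>Along the whole ray the Hessian is at least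
  \<open>(p / (1 + p * \<tau>))\<^sup>2\<close>, whose integral over the ray is \<open>p\<close>.
  Since the slope never becomes positive, it must start at or below \<open>- p\<close>.\<close>

lemma sqrt_ddF_le:
  assumes x: "x \<in> Q" and w: "w \<in> K"
  shows "sqrt (ddF F x w w) \<le> - dF F x w"
proof (rule field_le_epsilon)
  fix e :: real assume "e > 0"
  define p where "p = sqrt (ddF F x w w)"
  have p0: "p \<ge> 0" using ddF_nonneg[OF x] by (simp add: p_def)
  \<comment> \<open>The tail of the integral beyond \<open>a\<close> is
    \<open>p / (1 + p * a)\<close>, at most \<open>1 / a = e\<close>.\<close>
  define a where "a = 1 / e"
  have "a > 0" using \<open>e > 0\<close> by (simp add: a_def)
  let ?G = "\<lambda>\<tau>. dF F (x + \<tau> *\<^sub>R w) w + p / (1 + p * \<tau>)"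
  have "?G 0 \<le> ?G a"
  proof (rule DERIV_nonneg_imp_nondecreasing[where f = ?G])
    fix \<tau> assume \<tau>: "0 \<le> \<tau>" "\<tau> \<le> a"
    have Q: "x + \<tau> *\<^sub>R w \<in> Q" using \<tau> by (intro Q_ray x w)
    have pos: "1 + p * \<tau> > 0" using p0 \<tau> by (simp add: add_pos_nonneg)
    have "(?G has_real_derivative ddF F (x + \<tau> *\<^sub>R w) w w - (p / (1 + p * \<tau>))\<^sup>2) (at \<tau>)"
      using pos by (auto intro!: derivative_eq_intros dF_line[OF Q] simp: power2_eq_square)
    moreover have "(p / (1 + p * \<tau>))\<^sup>2 \<le> ddF F (x + \<tau> *\<^sub>R w) w w"
    proof -
      define b where "b = sqrt (ddF F (x + \<tau> *\<^sub>R w) w w)"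
      have "\<bar>b - p\<bar> \<le> \<tau> * p * b"
        unfolding b_def p_def by (intro sqrt_ddF_line Q_ray x w \<tau>)
      then have "p \<le> b * (1 + p * \<tau>)" by (simp add: algebra_simps)
      then have "p / (1 + p * \<tau>) \<le> b" using pos by (simp add: field_simps)
      then have "(p / (1 + p * \<tau>))\<^sup>2 \<le> b\<^sup>2" using p0 pos by (intro power_mono) auto
      then show ?thesis using ddF_nonneg[OF Q] by (simp add: b_def)
    qed
    ultimately show "\<exists>y. (?G has_real_derivative y) (at \<tau>) \<and> 0 \<le> y" by fastforce
  qed (use \<open>a > 0\<close> in simp)
  moreover have "dF F (x + a *\<^sub>R w) w \<le> 0"
    using \<open>a > 0\<close> by (intro dF_nonpos Q_ray x w) auto
  moreover have "p / (1 + p * a) \<le> e"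
  proof -
    have "p \<le> e * (1 + p * a)" using \<open>e > 0\<close> by (simp add: a_def algebra_simps)
    then show ?thesis using p0 \<open>a > 0\<close> by (simp add: field_simps add_pos_nonneg)
  qed
  ultimately show "sqrt (ddF F x w w) \<le> - dF F x w + e" by (simp add: p_def)
qed

text \<open>Along directions of the cone \<open>exp (- F)\<close> is convex, because
  \<open>F''(x)[w,w] \<le> (F'(x)[w])\<^sup>2\<close>.\<close>

lemma exp_decrease:
  assumes x: "x \<in> Q" and w: "w \<in> K" and "0 \<le> a"
  shows "1 + a * (- dF F x w) \<le> exp (\<phi> x - \<phi> (x + a *\<^sub>R w))"
proof -
  let ?G = "\<lambda>\<tau>. exp (- \<phi> (x + \<tau> *\<^sub>R w))"
  let ?G' = "\<lambda>\<tau>. - dF F (x + \<tau> *\<^sub>R w) w * exp (- \<phi> (x + \<tau> *\<^sub>R w))"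
  let ?G'' = "\<lambda>\<tau>. exp (- \<phi> (x + \<tau> *\<^sub>R w)) * ((dF F (x + \<tau> *\<^sub>R w) w)\<^sup>2 - ddF F (x + \<tau> *\<^sub>R w) w w)"
  have "?G' 0 * (a - 0) \<le> ?G a - ?G 0"
  proof (rule f''_imp_f'[of "{0..a}" ?G ?G' ?G''])
    fix \<tau> assume "\<tau> \<in> {0..a}"
    then have Q: "x + \<tau> *\<^sub>R w \<in> Q" using Q_ray[OF x w] by simp
    show "(?G has_real_derivative ?G' \<tau>) (at \<tau>)"
      by (auto intro!: derivative_eq_intros F_line[OF Q])
    show "(?G' has_real_derivative ?G'' \<tau>) (at \<tau>)"
      by (auto intro!: derivative_eq_intros F_line[OF Q] dF_line[OF Q] simp: power2_eq_square algebra_simps)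
    have "(sqrt (ddF F (x + \<tau> *\<^sub>R w) w w))\<^sup>2 \<le> (- dF F (x + \<tau> *\<^sub>R w) w)\<^sup>2"
      using ddF_nonneg[OF Q] by (intro power_mono sqrt_ddF_le[OF Q w]) auto
    then show "0 \<le> ?G'' \<tau>" using ddF_nonneg[OF Q] by simp
  qed (use \<open>0 \<le> a\<close> in auto)
  then have "exp (- \<phi> x) * (1 + a * (- dF F x w)) \<le> exp (- \<phi> (x + a *\<^sub>R w))"
    by (simp add: algebra_simps)
  then have "exp (\<phi> x) * (exp (- \<phi> x) * (1 + a * (- dF F x w))) \<le> exp (\<phi> x) * exp (- \<phi> (x + a *\<^sub>R w))"
    by (intro mult_left_mono) auto
  then show ?thesis
    by (simp add: mult.assoc[symmetric] exp_add[symmetric])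
qed

text \<open>Scaled to length \<open>r\<close>, the direction \<open>h\<close> becomes
  \<open>k\<close>, half the difference of the cone elements \<open>y + k\<close> and
  \<open>y - k\<close>. The parallelogram law and \<open>sqrt_ddF_le\<close> bound its Hessian by
  the slopes in these two directions, in whose sum \<open>k\<close> cancels.\<close>

lemma ddF_le_ball:
  assumes x: "x \<in> Q" and "r > 0" and ball: "cball y r \<subseteq> K"
  shows "ddF F x h h \<le> 2 * (norm h / r * dF F x y)\<^sup>2"
proof (cases "h = 0")
  case True
  then show ?thesis using ddF_scale[OF x, of 0 0] by simp
next
  case False
  define k where "k = (r / norm h) *\<^sub>R h"
  have "norm k = r" using False \<open>r > 0\<close> by (simp add: k_def)
  then have K: "y + k \<in> K" "y - k \<in> K" using ball by (auto simp: subset_iff dist_norm)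
  have sq: "ddF F x w w \<le> (- dF F x w)\<^sup>2" if "w \<in> K" for w
    using power_mono[OF sqrt_ddF_le[OF x that], of 2] ddF_nonneg[OF x, of w] by simp
  have "ddF F x (y + k - (y - k)) (y + k - (y - k)) = ddF F x (2 *\<^sub>R k) (2 *\<^sub>R k)"
    by (simp add: scaleR_2)
  also have "\<dots> = 4 * ddF F x k k" using ddF_scale[OF x] by simp
  finally have "4 * ddF F x k k \<le> 2 * ddF F x (y + k) (y + k) + 2 * ddF F x (y - k) (y - k)"
    using ddF_parallelogram[OF x, of "y + k" "y - k"] ddF_nonneg[OF x, of "y + k + (y - k)"] by simp
  also have "\<dots> \<le> 2 * (- dF F x (y + k))\<^sup>2 + 2 * (- dF F x (y - k))\<^sup>2"
    by (intro add_mono mult_left_mono sq K) auto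
  also have "\<dots> \<le> 2 * (- dF F x (y + k) + - dF F x (y - k))\<^sup>2"
  proof -
    have "a\<^sup>2 + b\<^sup>2 \<le> (a + b)\<^sup>2" if "a \<ge> 0" "b \<ge> 0" for a b :: real
      using that by (simp add: power2_sum)
    from this[of "- dF F x (y + k)" "- dF F x (y - k)"] show ?thesis
      using dF_nonpos[OF x K(1)] dF_nonpos[OF x K(2)] by simp
  qed
  also have "- dF F x (y + k) + - dF F x (y - k) = - 2 * dF F x y"
    by (simp add: linear_add[OF linear_dF[OF x]] linear_diff[OF linear_dF[OF x]])
  finally have "ddF F x k k \<le> 2 * (dF F x y)\<^sup>2" by (simp add: power_mult_distrib)
  then have "(r / norm h)\<^sup>2 * ddF F x h h \<le> 2 * (dF F x y)\<^sup>2"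
    unfolding k_def ddF_scale[OF x] .
  then show ?thesis
    using False \<open>r > 0\<close> by (simp add: field_simps power_divide power_mult_distrib)
qed

end

section \<open>Conditional gradient steps\<close>

text \<open>In the application \<open>K\<close> is the preimage of the original cone, so cone and
  \<open>X\<close> lie in one space. The point \<open>x0\<close> is fixed because it is also the
  interior reference point for all Hessian bounds.\<close>

locale cg_problem = canonical \<nu> K F
  for \<nu> :: real and K :: "'a::euclidean_space set" and F :: "'a \<Rightarrow> ereal" +
  fixes g :: "'a \<Rightarrow> ereal" and X :: "'a set" and \<Omega> :: real and x0 :: 'a
  assumes proper_g: "proper_fun g" and convex_g: "convex_fun g"
    and variation_g: "variation g X = ereal \<Omega>" and \<Omega>_pos: "\<Omega> > 0"
    and compact_X: "compact X" and convex_X: "convex X"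
    and x0: "x0 \<in> X \<inter> effdom F \<inter> effdom g"
begin

abbreviation C where "C \<equiv> X \<inter> effdom F \<inter> effdom g"
abbreviation \<gamma> where "\<gamma> \<equiv> \<lambda>x. real_of_ereal (g x)"

text \<open>The penalized objective multiplied by \<open>t\<close>, which leaves the barrier and its
  self-concordance constant unscaled. \<open>t * Gap\<close> is the decrease predicted by
  linearizing only the barrier part.\<close>

definition H :: "real \<Rightarrow> 'a \<Rightarrow> real" where
  "H t x = \<phi> x + t * \<gamma> x"

section \<open>Values of \<open>g\<close>, segments in \<open>X\<close> and optimality in the
  subproblem\<close>

lemma C_Q: "x \<in> C \<Longrightarrow> x \<in> Q"
  by (simp add: effdom_F)

lemma \<nu>_pos': "\<nu> > 0"
  by (rule \<nu>_pos[OF C_Q[OF x0]])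

lemma g_eq: "x \<in> effdom g \<Longrightarrow> g x = ereal (\<gamma> x)"
  using proper_g by (cases "g x") (auto simp: effdom_def proper_fun_def)

lemma g_convex:
  assumes "x \<in> effdom g" "y \<in> effdom g" "0 \<le> a" "a \<le> 1"
  shows "x + a *\<^sub>R (y - x) \<in> effdom g"
    and "\<gamma> (x + a *\<^sub>R (y - x)) \<le> \<gamma> x + a * (\<gamma> y - \<gamma> x)"
proof -
  have "(x, \<gamma> x) \<in> epi g" "(y, \<gamma> y) \<in> epi g"
    using assms by (simp_all add: epi_def g_eq[symmetric])
  then have "(1 - a) *\<^sub>R (x, \<gamma> x) + a *\<^sub>R (y, \<gamma> y) \<in> epi g"
    using convex_g assms unfolding convex_fun_def by (intro convexD) auto
  moreover have "(1 - a) *\<^sub>R x + a *\<^sub>R y = x + a *\<^sub>R (y - x)" by (simp add: algebra_simps)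
  ultimately have le: "g (x + a *\<^sub>R (y - x)) \<le> ereal (\<gamma> x + a * (\<gamma> y - \<gamma> x))"
    by (simp add: epi_def algebra_simps)
  then show in_dom: "x + a *\<^sub>R (y - x) \<in> effdom g"
    unfolding effdom_def by (auto intro: le_less_trans)
  show "\<gamma> (x + a *\<^sub>R (y - x)) \<le> \<gamma> x + a * (\<gamma> y - \<gamma> x)"
    using le g_eq[OF in_dom] by (metis ereal_less_eq(3))
qed

lemma X_convex: "x \<in> X \<Longrightarrow> y \<in> X \<Longrightarrow> 0 \<le> a \<Longrightarrow> a \<le> 1 \<Longrightarrow> x + a *\<^sub>R (y - x) \<in> X"
  using convexD_alt[OF convex_X, of x y a] by (simp add: algebra_simps)

lemma g_variation:
  assumes "x \<in> X \<inter> effdom g" "y \<in> X \<inter> effdom g"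
  shows "\<gamma> x - \<gamma> y \<le> \<Omega>"
proof -
  have "\<bar>g (fst (x, y)) - g (snd (x, y))\<bar> \<le> variation g X"
    unfolding variation_def using assms by (intro SUP_upper) auto
  then have "ereal \<bar>\<gamma> x - \<gamma> y\<bar> \<le> ereal \<Omega>"
    using g_eq[of x] g_eq[of y] assms variation_g by (metis IntD2 abs_ereal.simps(1) ereal_minus(1) fst_conv snd_conv)
  then show ?thesis by simp
qed

text \<open>A minimizer of the subproblem maximizes the expression that defines \<open>Gap\<close>.
  Comparison with \<open>x\<close> itself shows that \<open>g\<close> is finite there.\<close>

lemma
  assumes s: "lmo_selection F g X s" and t: "t > 0" and x: "x \<in> C"
  shows lmo_in: "s t x \<in> X \<inter> effdom g"
    and Gap_ge: "y \<in> X \<Longrightarrow> y \<in> effdom g \<Longrightarrow> dF F x (x - y) / t + \<gamma> x - \<gamma> y \<le> Gap F g s t x"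
proof -
  have min: "is_arg_min (\<lambda>y. ereal (dF F x y / t) + g y) (\<lambda>y. y \<in> X) (s t x)"
    using s t x by (simp add: lmo_selection_def)
  then have le: "ereal (dF F x (s t x) / t) + g (s t x) \<le> ereal (dF F x y / t) + g y" if "y \<in> X" for y
    using that by (auto simp: is_arg_min_def not_less)
  have "g (s t x) < \<infinity>"
    using le[of x] x g_eq[of x] by (cases "g (s t x)") auto
  then show *: "s t x \<in> X \<inter> effdom g"
    using min by (simp add: is_arg_min_def effdom_def)
  assume y: "y \<in> X" "y \<in> effdom g"
  have "dF F x (s t x) / t + \<gamma> (s t x) \<le> dF F x y / t + \<gamma> y"
    using le[OF y(1)] g_eq[of y] g_eq[of "s t x"] * y by (metis IntD2 ereal_less_eq(3) plus_ereal.simps(1))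
  then show "dF F x (x - y) / t + \<gamma> x - \<gamma> y \<le> Gap F g s t x"
    by (simp add: Gap_def linear_diff[OF linear_dF[OF C_Q[OF x]]] diff_divide_distrib)
qed

text \<open>Euler's identity gives \<open>- \<nu>\<close>, and the slope towards \<open>y\<close> is
  nonpositive. Both the restart and the accuracy estimate control the barrier term in this
  way.\<close>

lemma dF_diff_ge:
  assumes "x \<in> C" "y \<in> K"
  shows "dF F x (x - y) \<ge> - \<nu>"
  using dF_nonpos[OF C_Q assms(2)] assms(1)
  by (simp add: linear_diff[OF linear_dF[OF C_Q]] dF_self[OF C_Q])

text \<open>In both branches of the step size \<open>\<alpha> e (e + t Gap) \<le> t Gap\<close>, which bounds the quadratic
  error term \<open>(\<alpha> e)\<^sup>2 / (2 (1 - \<alpha> e))\<close> by half of the linear gain.\<close>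

lemma cg_step:
  assumes s: "lmo_selection F g X s" and t: "t > 0" and x: "x \<in> C" and gap: "Gap F g s t x > 0"
  defines "a \<equiv> step_size F g s t x"
  defines "x' \<equiv> x + a *\<^sub>R (s t x - x)"
  shows "x' \<in> C" and "H t x' \<le> H t x - a * (t * Gap F g s t x) / 2"
proof -
  define e where "e = loc_norm F s t x"
  define G where "G = t * Gap F g s t x"
  define h where "h = s t x - x"
  have xQ: "x \<in> Q" by (rule C_Q[OF x])
  have G0: "G > 0" using t gap by (simp add: G_def)
  have e_def': "e = sqrt (ddF F x h h)" by (simp add: e_def loc_norm_def h_def)
  have e0: "e \<ge> 0" using ddF_nonneg[OF xQ] by (simp add: e_def')
  have a_def': "a = (if e = 0 then 1 else min 1 (G / (e * (e + G))))"
    by (simp add: a_def step_size_def Let_def e_def G_def)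
  have a0: "0 < a" "a \<le> 1" using e0 G0 by (auto simp: a_def' add_pos_pos)
  have key: "a * e * (e + G) \<le> G"
  proof (cases "e = 0")
    case False
    have pos: "e * (e + G) > 0" using False e0 G0 by (intro mult_pos_pos) auto
    have "a * (e * (e + G)) \<le> G / (e * (e + G)) * (e * (e + G))"
      using False pos by (intro mult_right_mono) (auto simp: a_def')
    then show ?thesis using False e0 G0 by (simp add: mult.assoc)
  qed (use G0 in simp)
  \<comment> \<open>If \<open>a * e \<ge> 1\<close>, then \<open>key\<close> would give
    \<open>e + G \<le> G\<close> with \<open>e > 0\<close>.\<close>
  have r: "a * e < 1"
  proof (rule ccontr)
    assume "\<not> a * e < 1"
    then have "e + G \<le> a * e * (e + G)" "e > 0"
      using mult_right_mono[of 1 "a * e" "e + G"] e0 G0 by (auto simp: less_le)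
    then show False using key by simp
  qed
  have quad: "(a * e)\<^sup>2 / (2 * (1 - a * e)) \<le> a * G / 2"
  proof -
    have "a * e * e \<le> G * (1 - a * e)" using key by (simp add: algebra_simps)
    then have "a * (a * e * e) \<le> a * (G * (1 - a * e))" using a0 by (intro mult_left_mono) auto
    then show ?thesis using r by (simp add: field_simps power2_eq_square)
  qed
  have sX: "s t x \<in> X \<inter> effdom g" by (rule lmo_in[OF s t x])
  \<comment> \<open>Since \<open>s t x\<close> may lie outside the cone, it is the Dikin ellipsoid,
    not convexity, that keeps the step inside.\<close>
  have "x' \<in> Q" unfolding x'_def h_def[symmetric]
    using a0 r by (intro ellipsoid_subset xQ) (auto simp: e_def')
  then show "x' \<in> C"
    using sX x a0 g_convex(1)[of x "s t x" a] X_convex[of x "s t x" a] by (simp add: x'_def effdom_F)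
  have "\<phi> x' \<le> \<phi> x + a * dF F x h + (a * e)\<^sup>2 / (2 * (1 - a * e))"
    unfolding x'_def h_def[symmetric] e_def'
    using a0 r[unfolded e_def'] by (intro upper_bound xQ) auto
  with quad have "\<phi> x' \<le> \<phi> x + a * dF F x h + a * G / 2" by linarith
  moreover have "t * \<gamma> x' \<le> t * (\<gamma> x + a * (\<gamma> (s t x) - \<gamma> x))"
    unfolding x'_def using sX x a0 t by (intro mult_left_mono g_convex) auto
  moreover have "G = - dF F x h + t * (\<gamma> x - \<gamma> (s t x))"
    using t by (simp add: G_def Gap_def h_def linear_diff[OF linear_dF[OF xQ]] field_simps)
  then have "a * G = a * (- dF F x h + t * (\<gamma> x - \<gamma> (s t x)))" by simp
  ultimately show "H t x' \<le> H t x - a * (t * Gap F g s t x) / 2"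
    unfolding H_def G_def[symmetric] by (simp add: algebra_simps)
qed

text \<open>For a shortened step the product is \<open>G\<^sup>2 / (e * (e + G))\<close>, increasing
  in \<open>G\<close> and decreasing in \<open>e\<close>, so \<open>k\<close> and \<open>E\<close>
  may replace them. For a full step it is \<open>G \<ge> k\<close>.\<close>

lemma step_size_ge:
  assumes "x \<in> Q" and "loc_norm F s t x \<le> E" and "E > 0" and "0 < k" "k \<le> t * Gap F g s t x"
  shows "min k (k\<^sup>2 / (E * (E + k))) \<le> step_size F g s t x * (t * Gap F g s t x)"
proof -
  define e where "e = loc_norm F s t x"
  define G where "G = t * Gap F g s t x"
  have e0: "e \<ge> 0" using ddF_nonneg[OF assms(1)] by (simp add: e_def loc_norm_def)
  have le: "e \<le> E" "k \<le> G" using assms by (auto simp: e_def G_def)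
  have a: "step_size F g s t x = (if e = 0 then 1 else min 1 (G / (e * (e + G))))"
    by (simp add: step_size_def Let_def e_def G_def)
  have "k\<^sup>2 / (E * (E + k)) \<le> G / (e * (e + G)) * G" if "e \<noteq> 0"
  proof -
    have e: "e > 0" using that e0 by simp
    have "k / (E + k) \<le> G / (e + G)"
      using mult_mono[of k G e E] le e assms(3,4) by (simp add: field_simps)
    moreover have "k / E \<le> G / e"
      using le e assms(3,4) by (intro frac_le) auto
    ultimately have "k / (E + k) * (k / E) \<le> G / (e + G) * (G / e)"
      using le e assms(3,4) by (intro mult_mono) auto
    then show ?thesis by (simp add: power2_eq_square mult.commute)
  qed
  then show ?thesis
    using le assms(4) unfolding a G_def[symmetric]
    by (cases "e = 0") (auto simp: min_def)
qed

text \<open>A point that minimizes \<open>H t\<close> up to \<open>c\<close> cannot be improved by more than \<open>c\<close> by moving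
  towards \<open>x0\<close>, while by \<open>exp_decrease\<close> such a move decreases \<open>F\<close> by the logarithm of the slope.\<close>

lemma dF_x0_bound:
  assumes x: "x \<in> C" and t: "t > 0" and opt: "\<And>y. y \<in> C \<Longrightarrow> H t x \<le> H t y + c"
  shows "- dF F x x0 \<le> exp (c + 1) * (t * \<Omega> + \<nu>)"
proof -
  have xQ: "x \<in> Q" by (rule C_Q[OF x])
  have x0K: "x0 \<in> K" using C_Q[OF x0] interior_subset by blast
  \<comment> \<open>The move costs at most \<open>a * t * \<Omega>\<close> in the \<open>g\<close>
    part and \<open>a * \<nu>\<close> through rescaling the barrier. This choice makes the total 1,
    the summand in \<open>exp (c + 1)\<close>.\<close>
  define a where "a = 1 / (t * \<Omega> + \<nu>)"
  have D: "t * \<Omega> + \<nu> > 0" using t \<Omega>_pos \<nu>_pos' by (simp add: add_pos_pos)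
  then have a0: "a > 0" by (simp add: a_def)
  \<comment> \<open>With this weight, \<open>y\<close> on the segment from \<open>x\<close> to
    \<open>x0\<close> is the ray point \<open>x + a *\<^sub>R x0\<close> divided by
    \<open>1 + a\<close>: convexity governs \<open>\<gamma> y\<close>, homogeneity governs
    \<open>\<phi> y\<close>.\<close>
  define b where "b = a / (1 + a)"
  have b: "0 \<le> b" "b \<le> 1" "b \<le> a" using a0 by (auto simp: b_def field_simps)
  define y where "y = x + b *\<^sub>R (x0 - x)"
  have "(1 + a) *\<^sub>R y = x + a *\<^sub>R x0"
  proof -
    have "(1 + a) * b = a" using a0 by (simp add: b_def)
    then have "(1 + a) *\<^sub>R y = (1 + a) *\<^sub>R x + a *\<^sub>R (x0 - x)"
      unfolding y_def by (simp add: scaleR_add_right)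
    then show ?thesis by (simp add: algebra_simps)
  qed
  then have y_eq: "y = inverse (1 + a) *\<^sub>R (x + a *\<^sub>R x0)"
    using a0 by (metis add_pos_pos less_numeral_extra(1) less_numeral_extra(3) scaleR_left_imp_eq
        scaleR_one scaleR_scaleR left_inverse)
  have zQ: "x + a *\<^sub>R x0 \<in> Q" using a0 by (intro Q_ray xQ x0K) auto
  have "y \<in> Q" unfolding y_eq using a0 by (intro Q_scale zQ) auto
  then have yC: "y \<in> C"
    using x x0 b by (auto simp: y_def effdom_F intro!: X_convex g_convex)
  have \<phi>y: "\<phi> y = \<phi> (x + a *\<^sub>R x0) + \<nu> * ln (1 + a)"
    unfolding y_eq using a0 by (simp add: \<phi>_scale[OF zQ] ln_inverse)
  have "\<gamma> y \<le> \<gamma> x + b * (\<gamma> x0 - \<gamma> x)"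
    unfolding y_def using x x0 b by (intro g_convex) auto
  also have "b * (\<gamma> x0 - \<gamma> x) \<le> b * \<Omega>"
    using g_variation[of x0 x] x x0 b by (intro mult_left_mono) auto
  also have "b * \<Omega> \<le> a * \<Omega>" using b \<Omega>_pos by (intro mult_right_mono) auto
  finally have "t * \<gamma> y \<le> t * (\<gamma> x + a * \<Omega>)" using t by (intro mult_left_mono) auto
  moreover have "\<nu> * ln (1 + a) \<le> \<nu> * a"
    using a0 \<nu>_pos' by (intro mult_left_mono ln_add_one_self_le_self) auto
  moreover have "(t * \<Omega> + \<nu>) * a = 1" using D by (simp add: a_def)
  ultimately have "\<phi> x - \<phi> (x + a *\<^sub>R x0) \<le> c + 1"
    using opt[OF yC] unfolding H_def \<phi>y by (simp add: algebra_simps)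
  then have "exp (\<phi> x - \<phi> (x + a *\<^sub>R x0)) \<le> exp (c + 1)" by simp
  then have "a * (- dF F x x0) \<le> exp (c + 1)"
    using exp_decrease[OF xQ x0K less_imp_le[OF a0]] by linarith
  then show ?thesis using D by (simp add: a_def field_simps)
qed

text \<open>A ball around \<open>x0\<close> inside the cone and the boundedness of \<open>X\<close>
  turn \<open>ddF_le_ball\<close> into a bound with one constant, also for \<open>y\<close> outside
  the cone.\<close>

lemma loc_norm_bound:
  obtains M where "M > 0" "\<And>x y. x \<in> C \<Longrightarrow> y \<in> X \<Longrightarrow> sqrt (ddF F x (y - x) (y - x)) \<le> M * (- dF F x x0)"
proof -
  obtain r where r: "r > 0" "cball x0 r \<subseteq> K"
    using C_Q[OF x0] by (auto simp: mem_interior_cball)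
  obtain D where D: "D > 0" "\<And>x. x \<in> X \<Longrightarrow> norm x \<le> D"
    using compact_imp_bounded[OF compact_X] by (auto simp: bounded_pos)
  show thesis
  proof
    show "4 * D / r > 0" using r D by simp
    fix x y assume x: "x \<in> C" and y: "y \<in> X"
    define p where "p = - dF F x x0"
    have p: "p \<ge> 0"
      using dF_nonpos[OF C_Q[OF x], of x0] C_Q[OF x0] interior_subset by (auto simp: p_def)
    have "norm (y - x) \<le> 2 * D"
      using norm_triangle_ineq4[of y x] D(2)[OF y] D(2)[of x] x by simp
    then have "norm (y - x) / r * p \<le> 2 * D / r * p"
      using r p by (intro mult_right_mono divide_right_mono) auto
    then have "(norm (y - x) / r * p)\<^sup>2 \<le> (2 * D / r * p)\<^sup>2"
      using r p by (intro power_mono) auto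
    moreover have "ddF F x (y - x) (y - x) \<le> 2 * (norm (y - x) / r * p)\<^sup>2"
      using ddF_le_ball[OF C_Q[OF x] r, of "y - x"] by (simp add: p_def)
    ultimately have "ddF F x (y - x) (y - x) \<le> 2 * (2 * D / r * p)\<^sup>2" by simp
    \<comment> \<open>The factor 2 is raised to 4 to obtain a perfect square.\<close>
    also have "\<dots> \<le> 4 * (2 * D / r * p)\<^sup>2" by simp
    also have "\<dots> = (4 * D / r * p)\<^sup>2" by (simp add: power2_eq_square)
    finally show "sqrt (ddF F x (y - x) (y - x)) \<le> 4 * D / r * (- dF F x x0)"
      using r D p unfolding p_def[symmetric] by (intro real_le_lsqrt) auto
  qed
qed

text \<open>Each step lowers \<open>H t\<close> by \<open>\<delta>\<close>, and the total decrease
  cannot exceed \<open>c\<close>. As \<open>H t\<close> only decreases, near-minimality passes to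
  all iterates, so \<open>step\<close> may presuppose it.\<close>

lemma cg_stage:
  assumes x: "x \<in> C" and opt: "\<And>y. y \<in> C \<Longrightarrow> H t x \<le> H t y + c" and "\<delta> > 0"
    and step: "\<And>z. z \<in> C \<Longrightarrow> (\<And>y. y \<in> C \<Longrightarrow> H t z \<le> H t y + c) \<Longrightarrow> Gap F g s t z > \<eta> \<Longrightarrow>
      z + step_size F g s t z *\<^sub>R (s t z - z) \<in> C \<and>
      H t (z + step_size F g s t z *\<^sub>R (s t z - z)) \<le> H t z - \<delta>"
  shows "cg_terminates F g s x \<eta> t \<and> cg_point F g s x \<eta> t \<in> C \<and>
    Gap F g s t (cg_point F g s x \<eta> t) \<le> \<eta> \<and> \<delta> * cg_index F g s x \<eta> t \<le> c"
proof -
  define z where "z = cg_iter F g s t x"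
  have *: "z k \<in> C \<and> H t (z k) \<le> H t x - k * \<delta>" if "\<And>j. j < k \<Longrightarrow> Gap F g s t (z j) > \<eta>" for k
    using that
  proof (induction k)
    case 0
    then show ?case using x by (simp add: z_def)
  next
    case (Suc k)
    then have IH: "z k \<in> C" "H t (z k) \<le> H t x - k * \<delta>" by auto
    have "k * \<delta> \<ge> 0" using \<open>\<delta> > 0\<close> by simp
    have "z (Suc k) = z k + step_size F g s t (z k) *\<^sub>R (s t (z k) - z k)"
      by (simp add: z_def Let_def)
    moreover have "H t (z k) \<le> H t y + c" if "y \<in> C" for y
      using opt[OF that] IH(2) \<open>k * \<delta> \<ge> 0\<close> by linarith
    ultimately have "z (Suc k) \<in> C" "H t (z (Suc k)) \<le> H t (z k) - \<delta>"
      using step[OF IH(1)] Suc.prems[of k] by auto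
    then show ?case using IH(2) by (simp add: algebra_simps)
  qed
  have bound: "\<delta> * k \<le> c" if "\<And>j. j < k \<Longrightarrow> Gap F g s t (z j) > \<eta>" for k
  proof -
    have "z k \<in> C \<and> H t (z k) \<le> H t x - k * \<delta>" by (rule *) (rule that)
    then show ?thesis using opt[of "z k"] by (auto simp: mult.commute)
  qed
  have terminates: "cg_terminates F g s x \<eta> t"
  proof (rule ccontr)
    assume "\<not> ?thesis"
    then have "\<delta> * real k \<le> c" for k
      by (intro bound) (auto simp: cg_terminates_def z_def not_le)
    moreover obtain k :: nat where "c / \<delta> < real k" using reals_Archimedean2 by blast
    then have "c < \<delta> * real k" using \<open>\<delta> > 0\<close> by (simp add: field_simps)
    ultimately show False by (meson not_le)
  qed
  \<comment> \<open>Minimality of the index: every earlier iterate still has a large gap, as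
    \<open>*\<close> and \<open>bound\<close> require.\<close>
  have before: "Gap F g s t (z j) > \<eta>" if "j < cg_index F g s x \<eta> t" for j
    using not_less_Least[OF that[unfolded cg_index_def]] by (simp add: z_def)
  have "cg_point F g s x \<eta> t \<in> C"
    using *[OF before] by (simp add: cg_point_def z_def)
  moreover have "Gap F g s t (cg_point F g s x \<eta> t) \<le> \<eta>"
    using terminates LeastI_ex[of "\<lambda>k. Gap F g s t (cg_iter F g s t x k) \<le> \<eta>"]
    by (simp add: cg_point_def cg_index_def cg_terminates_def)
  moreover have "\<delta> * cg_index F g s x \<eta> t \<le> c" by (rule bound[OF before])
  ultimately show ?thesis using terminates by blast
qed

text \<open>The tolerance of the call with parameter \<open>t\<close> is
  \<open>2 * \<nu> / t\<close>. The constant \<open>\<kappa>\<close> is fixed before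
  \<open>s\<close>, \<open>t\<close> and \<open>x\<close>, so it serves all calls and all
  selections.\<close>

lemma cg_stage_complexity:
  obtains \<kappa> where "\<kappa> > 0"
    "\<And>s t x. lmo_selection F g X s \<Longrightarrow> t \<ge> \<nu> / \<Omega> \<Longrightarrow> x \<in> C \<Longrightarrow>
      (\<And>y. y \<in> C \<Longrightarrow> H t x \<le> H t y + c) \<Longrightarrow>
      cg_terminates F g s x (2 * \<nu> / t) t \<and> cg_point F g s x (2 * \<nu> / t) t \<in> C \<and>
      Gap F g s t (cg_point F g s x (2 * \<nu> / t) t) \<le> 2 * \<nu> / t \<and>
      \<kappa> / t\<^sup>2 * cg_index F g s x (2 * \<nu> / t) t \<le> c"
proof -
  obtain M where M: "M > 0"
    "\<And>x y. x \<in> C \<Longrightarrow> y \<in> X \<Longrightarrow> sqrt (ddF F x (y - x) (y - x)) \<le> M * (- dF F x x0)"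
    by (rule loc_norm_bound) blast
  define B where "B = M * exp (c + 1) * (2 * \<Omega>)"
  have B: "B > 0" using M(1) \<Omega>_pos by (simp add: B_def)
  define t0 where "t0 = \<nu> / \<Omega>"
  have t0: "t0 > 0" using \<nu>_pos' \<Omega>_pos by (simp add: t0_def)
  \<comment> \<open>The entries of the minimum belong to the full and the shortened step, both
    brought to the form constant over \<open>t\<^sup>2\<close>. The outer half is the one in
    \<open>cg_step\<close>.\<close>
  define \<kappa> where "\<kappa> = min (2 * \<nu> * t0\<^sup>2) ((2 * \<nu>)\<^sup>2 / (B * (B + 2 * \<Omega>))) / 2"
  have \<kappa>: "\<kappa> > 0" using B t0 \<nu>_pos' \<Omega>_pos by (simp add: \<kappa>_def add_pos_pos)
  show thesis
  proof (rule that[OF \<kappa>])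
    fix s t x
    assume s: "lmo_selection F g X s" and t_ge: "t \<ge> \<nu> / \<Omega>" and x: "x \<in> C"
      and opt: "\<And>y. y \<in> C \<Longrightarrow> H t x \<le> H t y + c"
    have t: "t > 0" using t0 t_ge by (simp add: t0_def)
    have \<nu>t: "\<nu> \<le> t * \<Omega>" using t_ge \<Omega>_pos by (simp add: field_simps)
    have step: "z + step_size F g s t z *\<^sub>R (s t z - z) \<in> C \<and>
        H t (z + step_size F g s t z *\<^sub>R (s t z - z)) \<le> H t z - \<kappa> / t\<^sup>2"
      if z: "z \<in> C" and zopt: "\<And>y. y \<in> C \<Longrightarrow> H t z \<le> H t y + c" and gap: "Gap F g s t z > 2 * \<nu> / t" for z
    proof -
      have gap0: "Gap F g s t z > 0" using gap \<nu>_pos' t by (smt (verit) divide_pos_pos)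
      have "loc_norm F s t z \<le> M * (- dF F z x0)"
        unfolding loc_norm_def using lmo_in[OF s t z] by (intro M z) auto
      also have "\<dots> \<le> M * (exp (c + 1) * (t * \<Omega> + \<nu>))"
        using M(1) by (intro mult_left_mono dF_x0_bound z t zopt) auto
      also have "\<dots> \<le> M * (exp (c + 1) * (t * \<Omega> + t * \<Omega>))"
        using M(1) \<nu>t by (intro mult_left_mono add_left_mono) auto
      also have "\<dots> = B * t" by (simp add: B_def)
      finally have "loc_norm F s t z \<le> B * t" .
      then have ge: "min (2 * \<nu>) ((2 * \<nu>)\<^sup>2 / (B * t * (B * t + 2 * \<nu>)))
          \<le> step_size F g s t z * (t * Gap F g s t z)"
        using B t \<nu>_pos' gap by (intro step_size_ge C_Q[OF z]) (auto simp: field_simps)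
      have "2 * \<nu> * t0\<^sup>2 / t\<^sup>2 \<le> 2 * \<nu>"
        using t0 t_ge \<nu>_pos' t power_mono[of t0 t 2] by (simp add: t0_def[symmetric] field_simps)
      moreover have "(2 * \<nu>)\<^sup>2 / (B * (B + 2 * \<Omega>)) / t\<^sup>2 \<le> (2 * \<nu>)\<^sup>2 / (B * t * (B * t + 2 * \<nu>))"
      proof -
        have "B * t * (B * t + 2 * \<nu>) \<le> B * t * (B * t + 2 * (t * \<Omega>))"
          using B t \<nu>t by (intro mult_left_mono add_left_mono) auto
        also have "\<dots> = B * (B + 2 * \<Omega>) * t\<^sup>2" by (simp add: power2_eq_square algebra_simps)
        finally show ?thesis
          using B t \<nu>_pos' \<Omega>_pos by (simp only: divide_divide_eq_left) (intro divide_left_mono mult_pos_pos, auto simp: add_pos_pos)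
      qed
      moreover have "2 * \<kappa> / t\<^sup>2 \<le> 2 * \<nu> * t0\<^sup>2 / t\<^sup>2"
        "2 * \<kappa> / t\<^sup>2 \<le> (2 * \<nu>)\<^sup>2 / (B * (B + 2 * \<Omega>)) / t\<^sup>2"
        by (intro divide_right_mono; simp add: \<kappa>_def)+
      ultimately have "2 * \<kappa> / t\<^sup>2 \<le> min (2 * \<nu>) ((2 * \<nu>)\<^sup>2 / (B * t * (B * t + 2 * \<nu>)))"
        by linarith
      also note ge
      finally have "\<kappa> / t\<^sup>2 \<le> step_size F g s t z * (t * Gap F g s t z) / 2"
        by (simp add: mult.commute)
      then show ?thesis using cg_step[OF s t z gap0] by auto
    qed
    show "cg_terminates F g s x (2 * \<nu> / t) t \<and> cg_point F g s x (2 * \<nu> / t) t \<in> C \<and>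
      Gap F g s t (cg_point F g s x (2 * \<nu> / t) t) \<le> 2 * \<nu> / t \<and>
      \<kappa> / t\<^sup>2 * cg_index F g s x (2 * \<nu> / t) t \<le> c"
    proof -
      have "\<kappa> / t\<^sup>2 > 0" using \<kappa> t by simp
      then show ?thesis
        by (rule cg_stage[OF x, rotated]) (fact opt step)+
    qed
  qed
qed

section \<open>Near-optimal starting points for successive calls\<close>

lemma near_optimal_start:
  assumes "t > 0"
  obtains c where "\<And>y. y \<in> C \<Longrightarrow> H t x0 \<le> H t y + c"
proof -
  obtain D where D: "\<And>x. x \<in> X \<Longrightarrow> norm x \<le> D"
    using compact_imp_bounded[OF compact_X] by (auto simp: bounded_iff)
  obtain B where B: "B > 0" "\<And>y. norm (dF F x0 y) \<le> B * norm y"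
    using linear_bounded_pos[OF linear_dF[OF C_Q[OF x0]]] by blast
  show thesis
  proof
    fix y assume y: "y \<in> C"
    \<comment> \<open>The tangent at \<open>x0\<close> bounds \<open>\<phi>\<close> from below and
      is itself bounded on \<open>X\<close>; the variation \<open>\<Omega>\<close> bounds the rest
      of \<open>H t\<close>.\<close>
    have "dF F x0 (y - x0) \<le> \<phi> y - \<phi> x0" by (intro dF_gradient C_Q x0 y)
    moreover have "dF F x0 (y - x0) = dF F x0 y + \<nu>"
      by (simp add: linear_diff[OF linear_dF[OF C_Q[OF x0]]] dF_self[OF C_Q[OF x0]])
    moreover have "\<bar>dF F x0 y\<bar> \<le> B * D"
    proof -
      have "B * norm y \<le> B * D" using D[of y] y B(1) by (intro mult_left_mono) auto
      then show ?thesis using B(2)[of y] by simp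
    qed
    moreover have "t * (\<gamma> x0 - \<gamma> y) \<le> t * \<Omega>"
      using g_variation[of x0 y] x0 y assms by (intro mult_left_mono) auto
    ultimately show "H t x0 \<le> H t y + (B * D - \<nu> + t * \<Omega>)"
      by (simp add: H_def algebra_simps)
  qed
qed

text \<open>The gap inequality for \<open>t\<close>, divided by \<open>\<sigma>\<close>, bounds the
  \<open>g\<close> part by \<open>2 * \<nu> / \<sigma> - D / \<sigma>\<close>; the gradient
  inequality bounds the barrier part by \<open>D\<close>. Since \<open>D \<ge> - \<nu>\<close> and
  \<open>1 - 1 / \<sigma>\<close> is negative, \<open>D - D / \<sigma>\<close> is below
  \<open>\<nu> / \<sigma>\<close>.\<close>

lemma near_optimal_next:
  assumes s: "lmo_selection F g X s" and t: "t > 0" and x: "x \<in> C"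
    and gap: "Gap F g s t x \<le> 2 * \<nu> / t" and \<sigma>: "0 < \<sigma>" "\<sigma> < 1" and y: "y \<in> C"
  shows "H (t / \<sigma>) x \<le> H (t / \<sigma>) y + 3 * \<nu> / \<sigma>"
proof -
  define D where "D = dF F x (x - y)"
  have "D / t + (\<gamma> x - \<gamma> y) \<le> 2 * \<nu> / t"
    using Gap_ge[OF s t x, of y] gap y by (simp add: D_def)
  then have "t * (D / t + (\<gamma> x - \<gamma> y)) \<le> t * (2 * \<nu> / t)"
    using t by (intro mult_left_mono) auto
  then have "D + t * (\<gamma> x - \<gamma> y) \<le> 2 * \<nu>"
    using t by (simp add: distrib_left)
  then have "(D + t * (\<gamma> x - \<gamma> y)) / \<sigma> \<le> 2 * \<nu> / \<sigma>"
    using \<sigma> by (intro divide_right_mono) auto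
  then have 1: "t / \<sigma> * (\<gamma> x - \<gamma> y) \<le> 2 * \<nu> / \<sigma> - D / \<sigma>"
    by (simp add: add_divide_distrib)
  have "D \<ge> - \<nu>"
    unfolding D_def using C_Q[OF y] interior_subset by (intro dF_diff_ge x) blast
  then have "(1 - 1 / \<sigma>) * D \<le> (1 - 1 / \<sigma>) * (- \<nu>)"
    using \<sigma> by (intro mult_left_mono_neg) (auto simp: field_simps)
  then have 2: "D - D / \<sigma> \<le> \<nu> / \<sigma> - \<nu>" by (simp add: algebra_simps)
  have "dF F x (y - x) \<le> \<phi> y - \<phi> x" by (intro dF_gradient C_Q x y)
  then have 3: "\<phi> x - \<phi> y \<le> D"
    by (simp add: D_def linear_diff[OF linear_dF[OF C_Q[OF x]]])
  have "3 * \<nu> / \<sigma> = 2 * \<nu> / \<sigma> + \<nu> / \<sigma>" by (simp add: field_simps)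
  with 1 2 3 show ?thesis
    using \<nu>_pos' by (simp add: H_def right_diff_distrib)
qed

text \<open>Induction on the calls, the invariant being near-minimality of the starting point with
  one common \<open>c\<close>. \<open>A\<close> is chosen before \<open>s\<close> and
  \<open>i\<close>, so the bounds can be summed and hold for selections that vary with the
  accuracy.\<close>

lemma homotopy_calls:
  assumes \<sigma>: "0 < \<sigma>" "\<sigma> < 1"
  obtains A where "A \<ge> 0"
    "\<And>s i. lmo_selection F g X s \<Longrightarrow>
      \<exists>x. call_args F g s \<sigma> x0 (2 * \<Omega>) (\<nu> / \<Omega>) i = (x, 2 * \<Omega> * \<sigma> ^ i, \<nu> / \<Omega> / \<sigma> ^ i) \<and>
        cg_terminates F g s x (2 * \<Omega> * \<sigma> ^ i) (\<nu> / \<Omega> / \<sigma> ^ i) \<and>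
        cg_point F g s x (2 * \<Omega> * \<sigma> ^ i) (\<nu> / \<Omega> / \<sigma> ^ i) \<in> C \<and>
        Gap F g s (\<nu> / \<Omega> / \<sigma> ^ i) (cg_point F g s x (2 * \<Omega> * \<sigma> ^ i) (\<nu> / \<Omega> / \<sigma> ^ i)) \<le> 2 * \<Omega> * \<sigma> ^ i \<and>
        cg_index F g s x (2 * \<Omega> * \<sigma> ^ i) (\<nu> / \<Omega> / \<sigma> ^ i) \<le> A / (\<sigma> ^ i)\<^sup>2"
proof -
  define T where "T = (\<lambda>i. \<nu> / \<Omega> / \<sigma> ^ i)"
  define \<eta> where "\<eta> = (\<lambda>i. 2 * \<Omega> * \<sigma> ^ i)"
  have T: "T i > 0" for i using \<nu>_pos' \<Omega>_pos \<sigma> by (simp add: T_def)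
  have T_ge: "T i \<ge> \<nu> / \<Omega>" for i
  proof -
    have "\<sigma> ^ i \<le> 1" using \<sigma> by (intro power_le_one) auto
    then have "\<nu> / \<Omega> / 1 \<le> T i"
      unfolding T_def using \<nu>_pos' \<Omega>_pos \<sigma> by (intro divide_left_mono) auto
    then show ?thesis by simp
  qed
  have \<eta>: "\<eta> i = 2 * \<nu> / T i" for i
    using \<nu>_pos' \<Omega>_pos \<sigma> by (simp add: \<eta>_def T_def)
  obtain c0 where c0: "\<And>y. y \<in> C \<Longrightarrow> H (T 0) x0 \<le> H (T 0) y + c0"
    using near_optimal_start[OF T[of 0]] by blast
  \<comment> \<open>\<open>c0\<close> covers the first call, \<open>3 * \<nu> / \<sigma>\<close>
    every later one.\<close>
  define c where "c = max c0 (3 * \<nu> / \<sigma>)"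
  have c: "c \<ge> 0" using \<nu>_pos' \<sigma> by (simp add: c_def le_max_iff_disj)
  obtain \<kappa> where \<kappa>: "\<kappa> > 0"
    "\<And>s t x. lmo_selection F g X s \<Longrightarrow> t \<ge> \<nu> / \<Omega> \<Longrightarrow> x \<in> C \<Longrightarrow>
      (\<And>y. y \<in> C \<Longrightarrow> H t x \<le> H t y + c) \<Longrightarrow>
      cg_terminates F g s x (2 * \<nu> / t) t \<and> cg_point F g s x (2 * \<nu> / t) t \<in> C \<and>
      Gap F g s t (cg_point F g s x (2 * \<nu> / t) t) \<le> 2 * \<nu> / t \<and>
      \<kappa> / t\<^sup>2 * cg_index F g s x (2 * \<nu> / t) t \<le> c"
    using cg_stage_complexity[of c] by blast
  \<comment> \<open>Comes from index at most \<open>c * (T i)\<^sup>2 / \<kappa>\<close> with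
    \<open>T i = \<nu> / \<Omega> / \<sigma> ^ i\<close>.\<close>
  define A where "A = c * (\<nu> / \<Omega>)\<^sup>2 / \<kappa>"
  have A: "A \<ge> 0" using c \<kappa>(1) by (simp add: A_def)
  have call: "cg_terminates F g s x (\<eta> i) (T i) \<and> cg_point F g s x (\<eta> i) (T i) \<in> C \<and>
      Gap F g s (T i) (cg_point F g s x (\<eta> i) (T i)) \<le> \<eta> i \<and>
      cg_index F g s x (\<eta> i) (T i) \<le> A / (\<sigma> ^ i)\<^sup>2"
    if "lmo_selection F g X s" "x \<in> C" "\<And>y. y \<in> C \<Longrightarrow> H (T i) x \<le> H (T i) y + c" for s x i
  proof -
    define R where "R = real (cg_index F g s x (\<eta> i) (T i))"
    have *: "cg_terminates F g s x (\<eta> i) (T i) \<and> cg_point F g s x (\<eta> i) (T i) \<in> C \<and>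
      Gap F g s (T i) (cg_point F g s x (\<eta> i) (T i)) \<le> \<eta> i \<and> \<kappa> / (T i)\<^sup>2 * R \<le> c"
      unfolding R_def \<eta> by (rule \<kappa>(2)[OF that(1) T_ge that(2) that(3)])
    then have "R \<le> c * (T i)\<^sup>2 / \<kappa>"
      using \<kappa>(1) T[of i] by (simp add: field_simps)
    also have "\<dots> = A / (\<sigma> ^ i)\<^sup>2" by (simp add: A_def T_def power_divide power_mult_distrib)
    finally show ?thesis using * by (simp add: R_def)
  qed
  have inv: "\<exists>x\<in>C. call_args F g s \<sigma> x0 (2 * \<Omega>) (\<nu> / \<Omega>) i = (x, \<eta> i, T i) \<and>
      (\<forall>y\<in>C. H (T i) x \<le> H (T i) y + c)" if s: "lmo_selection F g X s" for s i
  proof (induction i)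
    case 0
    have "\<forall>y\<in>C. H (T 0) x0 \<le> H (T 0) y + c"
      using c0 by (force simp: c_def)
    then show ?case using x0 by (intro bexI[of _ x0]) (auto simp: \<eta>_def T_def)
  next
    case (Suc i)
    then obtain x where x: "x \<in> C" "call_args F g s \<sigma> x0 (2 * \<Omega>) (\<nu> / \<Omega>) i = (x, \<eta> i, T i)"
      "\<And>y. y \<in> C \<Longrightarrow> H (T i) x \<le> H (T i) y + c" by blast
    define z where "z = cg_point F g s x (\<eta> i) (T i)"
    have z: "z \<in> C" "Gap F g s (T i) z \<le> 2 * \<nu> / T i"
      using call[OF s x(1,3)] by (auto simp: z_def \<eta>)
    have T_Suc: "T (Suc i) = T i / \<sigma>" by (simp add: T_def field_simps)
    have "\<forall>y\<in>C. H (T (Suc i)) z \<le> H (T (Suc i)) y + c"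
    proof
      fix y assume "y \<in> C"
      then have "H (T i / \<sigma>) z \<le> H (T i / \<sigma>) y + 3 * \<nu> / \<sigma>"
        by (rule near_optimal_next[OF s T z \<sigma>])
      then show "H (T (Suc i)) z \<le> H (T (Suc i)) y + c"
        unfolding T_Suc c_def by linarith
    qed
    moreover have "call_args F g s \<sigma> x0 (2 * \<Omega>) (\<nu> / \<Omega>) (Suc i) = (z, \<eta> (Suc i), T (Suc i))"
      using x(2) by (simp add: z_def T_Suc) (simp add: \<eta>_def)
    ultimately show ?case using z(1) by blast
  qed
  show thesis
  proof (rule that[OF A])
    fix s i assume s: "lmo_selection F g X s"
    from inv[OF this, of i] obtain x where x: "x \<in> C"
      "call_args F g s \<sigma> x0 (2 * \<Omega>) (\<nu> / \<Omega>) i = (x, \<eta> i, T i)"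
      "\<And>y. y \<in> C \<Longrightarrow> H (T i) x \<le> H (T i) y + c" by blast
    show "\<exists>x. call_args F g s \<sigma> x0 (2 * \<Omega>) (\<nu> / \<Omega>) i = (x, 2 * \<Omega> * \<sigma> ^ i, \<nu> / \<Omega> / \<sigma> ^ i) \<and>
        cg_terminates F g s x (2 * \<Omega> * \<sigma> ^ i) (\<nu> / \<Omega> / \<sigma> ^ i) \<and>
        cg_point F g s x (2 * \<Omega> * \<sigma> ^ i) (\<nu> / \<Omega> / \<sigma> ^ i) \<in> C \<and>
        Gap F g s (\<nu> / \<Omega> / \<sigma> ^ i) (cg_point F g s x (2 * \<Omega> * \<sigma> ^ i) (\<nu> / \<Omega> / \<sigma> ^ i)) \<le> 2 * \<Omega> * \<sigma> ^ i \<and>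
        cg_index F g s x (2 * \<Omega> * \<sigma> ^ i) (\<nu> / \<Omega> / \<sigma> ^ i) \<le> A / (\<sigma> ^ i)\<^sup>2"
      using call[OF s x(1,3)] x(2) unfolding \<eta>_def T_def by blast
  qed
qed

lemma Gap_imp_near_minimal:
  assumes s: "lmo_selection F g X s" and t: "t > 0" and x: "x \<in> C"
    and y: "y \<in> X" "y \<in> K"
  shows "g x \<le> g y + ereal (Gap F g s t x + \<nu> / t)"
proof (cases "y \<in> effdom g")
  case True
  have "dF F x (x - y) / t \<ge> (- \<nu>) / t"
    using t by (intro divide_right_mono dF_diff_ge x y) auto
  then have "\<gamma> x \<le> \<gamma> y + (Gap F g s t x + \<nu> / t)"
    using Gap_ge[OF s t x y(1) True] by simp
  then show ?thesis using g_eq[OF True] g_eq[of x] x by (metis IntD2 ereal_less_eq(3) plus_ereal.simps(1))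
next
  case False
  then show ?thesis by (simp add: effdom_def)
qed

end

section \<open>Number of stages and the geometric sum\<close>

lemma num_stages_upper:
  assumes "0 < \<sigma>" "\<sigma> < 1" "0 < \<epsilon>" "0 < \<eta>0"
  shows "\<sigma> ^ num_stages \<sigma> \<eta>0 \<epsilon> \<le> \<epsilon> / (2 * \<eta>0)"
proof -
  have l: "ln (1 / \<sigma>) > 0" using assms by simp
  have "ln (2 * \<eta>0 / \<epsilon>) / ln (1 / \<sigma>) \<le> real (num_stages \<sigma> \<eta>0 \<epsilon>)"
    unfolding num_stages_def by (rule real_nat_ceiling_ge)
  then have "ln (2 * \<eta>0 / \<epsilon>) \<le> real (num_stages \<sigma> \<eta>0 \<epsilon>) * ln (1 / \<sigma>)"
    using l by (simp add: field_simps)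
  also have "\<dots> = ln ((1 / \<sigma>) ^ num_stages \<sigma> \<eta>0 \<epsilon>)"
    using assms by (subst ln_realpow) auto
  finally have "2 * \<eta>0 / \<epsilon> \<le> (1 / \<sigma>) ^ num_stages \<sigma> \<eta>0 \<epsilon>"
    using assms by (subst (asm) ln_le_cancel_iff) auto
  then show ?thesis using assms by (simp add: field_simps)
qed

text \<open>For \<open>\<epsilon> \<le> 2 * \<eta>0\<close> the quotient of logarithms is
  nonnegative, so \<open>nat\<close> truncates nothing and rounding up costs at most one factor
  \<open>\<sigma>\<close>.\<close>

lemma num_stages_lower:
  assumes "0 < \<sigma>" "\<sigma> < 1" "0 < \<epsilon>" "\<epsilon> \<le> 2 * \<eta>0"
  shows "\<sigma> * \<epsilon> / (2 * \<eta>0) \<le> \<sigma> ^ num_stages \<sigma> \<eta>0 \<epsilon>"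
proof -
  have l: "ln (1 / \<sigma>) > 0" using assms by simp
  have "ln (2 * \<eta>0 / \<epsilon>) / ln (1 / \<sigma>) \<ge> 0"
    using assms l by (intro divide_nonneg_pos) (auto simp: field_simps)
  then have "real (num_stages \<sigma> \<eta>0 \<epsilon>) - 1 \<le> ln (2 * \<eta>0 / \<epsilon>) / ln (1 / \<sigma>)"
    unfolding num_stages_def by linarith
  then have "(real (num_stages \<sigma> \<eta>0 \<epsilon>) - 1) * ln (1 / \<sigma>) \<le> ln (2 * \<eta>0 / \<epsilon>)"
    using l by (simp add: field_simps)
  then have "real (num_stages \<sigma> \<eta>0 \<epsilon>) * ln (1 / \<sigma>) \<le> ln (2 * \<eta>0 / \<epsilon>) + ln (1 / \<sigma>)"
    by (simp add: algebra_simps)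
  moreover have "real (num_stages \<sigma> \<eta>0 \<epsilon>) * ln (1 / \<sigma>) = ln ((1 / \<sigma>) ^ num_stages \<sigma> \<eta>0 \<epsilon>)"
    using assms by (subst ln_realpow) auto
  moreover have "ln (2 * \<eta>0 / \<epsilon>) + ln (1 / \<sigma>) = ln (2 * \<eta>0 / \<epsilon> * (1 / \<sigma>))"
    using assms by (subst ln_mult) auto
  ultimately have "ln ((1 / \<sigma>) ^ num_stages \<sigma> \<eta>0 \<epsilon>) \<le> ln (2 * \<eta>0 / \<epsilon> * (1 / \<sigma>))"
    by simp
  then have "(1 / \<sigma>) ^ num_stages \<sigma> \<eta>0 \<epsilon> \<le> 2 * \<eta>0 / \<epsilon> * (1 / \<sigma>)"
    using assms by (subst (asm) ln_le_cancel_iff) auto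
  then show ?thesis using assms by (simp add: field_simps)
qed

text \<open>A geometric sum is dominated by its last term. In this product form the induction step
  closes with an equality, as \<open>1 / (\<sigma> ^ n)\<^sup>2\<close> is
  \<open>\<sigma>\<^sup>2\<close> times the next term.\<close>

lemma sum_inverse_powers_le:
  fixes \<sigma> :: real
  assumes "0 < \<sigma>"
  shows "(1 - \<sigma>\<^sup>2) * (\<Sum>i\<le>n. 1 / (\<sigma> ^ i)\<^sup>2) \<le> 1 / (\<sigma> ^ n)\<^sup>2"
proof (induction n)
  case (Suc n)
  have "(1 - \<sigma>\<^sup>2) * (\<Sum>i\<le>Suc n. 1 / (\<sigma> ^ i)\<^sup>2)
      \<le> 1 / (\<sigma> ^ n)\<^sup>2 + (1 - \<sigma>\<^sup>2) * (1 / (\<sigma> ^ Suc n)\<^sup>2)"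
    using Suc by (simp add: distrib_left)
  also have "\<dots> = 1 / (\<sigma> ^ Suc n)\<^sup>2"
    using assms by (simp add: field_simps power_mult_distrib)
  finally show ?case .
qed simp

section \<open>Accuracy of the output and the total iteration count\<close>

theorem theorem3p3:
  fixes g :: "'e::euclidean_space \<Rightarrow> ereal"
    and K :: "'h::euclidean_space set"
    and f :: "'h \<Rightarrow> ereal"
    and P :: "'e \<Rightarrow> 'h"
    and F :: "'e \<Rightarrow> ereal"
    and X :: "'e set"
    and \<nu> \<Omega> \<sigma> t0 \<eta>0 :: real
    and x0 :: 'e
    and s :: "real \<Rightarrow> real \<Rightarrow> 'e \<Rightarrow> 'e"
  assumes g: "proper_fun g" "closed_fun g" "convex_fun g" "continuous_on (effdom g) g"
    and Omega: "variation g X = ereal \<Omega>" "\<Omega> > 0"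
    and K: "closed K" "convex_cone K" "pointed K" "interior K \<noteq> {}"
    and f: "canonical_barrier \<nu> K f"
    and P: "linear P"
    and F_eq: "F = (\<lambda>x. f (P x))"
    and F: "canonical_barrier \<nu> (P -` K) F"
    and X: "X \<noteq> {}" "compact X" "convex X"
    and \<sigma>: "0 < \<sigma>" "\<sigma> < 1"
    and x0: "x0 \<in> X \<inter> effdom F \<inter> effdom g"
    and t0: "t0 = \<nu> / \<Omega>"
    and \<eta>0: "\<eta>0 = 2 * \<Omega>"
    and s: "\<And>\<epsilon>. 0 < \<epsilon> \<Longrightarrow> \<epsilon> < 1 \<Longrightarrow> lmo_selection F g X (s \<epsilon>)"
  shows "(\<forall>\<epsilon>. 0 < \<epsilon> \<and> \<epsilon> < 1 \<longrightarrow>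
            homotopy_terminates F g (s \<epsilon>) \<sigma> x0 \<eta>0 t0 \<epsilon> \<and>
            eps_solution g X P K \<epsilon> (homotopy_output F g (s \<epsilon>) \<sigma> x0 \<eta>0 t0 \<epsilon>)) \<and>
         soft_bigo
           (\<lambda>\<epsilon>. real (Compl F g (s \<epsilon>) \<sigma> x0 \<eta>0 t0 \<epsilon>))
           (\<lambda>\<epsilon>. 384 * \<Omega>\<^sup>2 * \<nu> / (\<epsilon>\<^sup>2 * (1 - \<sigma>\<^sup>2)) +
                 \<Omega> * ln (21.2 * \<nu> * (1 + 2 / \<epsilon> * \<Omega>)) * (21.2 * \<nu> / \<epsilon>) * ((2 - \<sigma>) / (1 - \<sigma>)))"
proof -
  \<comment> \<open>A ball around 0 inside \<open>K\<close> would contain a nonzero vector and its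
    negative.\<close>
  have zero: "0 \<notin> interior K"
  proof
    assume "0 \<in> interior K"
    then obtain r where r: "r > 0" "cball 0 r \<subseteq> K" by (auto simp: mem_interior_cball)
    obtain b :: 'h where b: "norm b = 1" using SOME_Basis norm_Basis by blast
    then have "r *\<^sub>R b \<in> K" "- (r *\<^sub>R b) \<in> K" using r by auto
    then have "r *\<^sub>R b = 0" using K(3) unfolding pointed_def by blast
    then show False using r b by auto
  qed
  \<comment> \<open>Both interiors are effective domains, of \<open>F\<close> and of
    \<open>f\<close>, and \<open>P 0 = 0\<close>, so the previous fact transfers.\<close>
  have "0 \<notin> interior (P -` K)"
  proof -
    have "effdom F = interior (P -` K)" "effdom f = interior K"
      using F f by (auto simp: canonical_barrier_def self_concordant_barrier_def)
    moreover have "0 \<in> effdom F \<longleftrightarrow> 0 \<in> effdom f"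
      using linear_0[OF P] by (simp add: effdom_def F_eq)
    ultimately show ?thesis using zero by simp
  qed
  then interpret cg_problem \<nu> "P -` K" F g X \<Omega> x0
    using F g Omega X x0 by unfold_locales
  \<comment> \<open>Each accuracy may come with its own selection \<open>s \<epsilon>\<close>; the
    asymptotic constant must not depend on it.\<close>
  obtain A where A: "A \<ge> 0" and calls: "\<And>s i. lmo_selection F g X s \<Longrightarrow>
      \<exists>x. call_args F g s \<sigma> x0 (2 * \<Omega>) (\<nu> / \<Omega>) i = (x, 2 * \<Omega> * \<sigma> ^ i, \<nu> / \<Omega> / \<sigma> ^ i) \<and>
        cg_terminates F g s x (2 * \<Omega> * \<sigma> ^ i) (\<nu> / \<Omega> / \<sigma> ^ i) \<and>
        cg_point F g s x (2 * \<Omega> * \<sigma> ^ i) (\<nu> / \<Omega> / \<sigma> ^ i) \<in> C \<and>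
        Gap F g s (\<nu> / \<Omega> / \<sigma> ^ i) (cg_point F g s x (2 * \<Omega> * \<sigma> ^ i) (\<nu> / \<Omega> / \<sigma> ^ i)) \<le> 2 * \<Omega> * \<sigma> ^ i \<and>
        cg_index F g s x (2 * \<Omega> * \<sigma> ^ i) (\<nu> / \<Omega> / \<sigma> ^ i) \<le> A / (\<sigma> ^ i)\<^sup>2"
    using homotopy_calls[OF \<sigma>] by blast
  let ?I = "num_stages \<sigma> \<eta>0"
  have solution: "eps_solution g X P K \<epsilon> (homotopy_output F g (s \<epsilon>) \<sigma> x0 \<eta>0 t0 \<epsilon>)"
    if \<epsilon>: "0 < \<epsilon>" "\<epsilon> < 1" for \<epsilon>
  proof -
    define t where "t = \<nu> / \<Omega> / \<sigma> ^ ?I \<epsilon>"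
    define z where "z = homotopy_output F g (s \<epsilon>) \<sigma> x0 \<eta>0 t0 \<epsilon>"
    have t: "t > 0" using \<nu>_pos' \<Omega>_pos \<sigma> by (simp add: t_def)
    from calls[OF s[OF \<epsilon>], of "?I \<epsilon>"] have z: "z \<in> C" "Gap F g (s \<epsilon>) t z \<le> 2 * \<Omega> * \<sigma> ^ ?I \<epsilon>"
      by (auto simp: z_def t_def homotopy_output_def t0 \<eta>0)
    \<comment> \<open>The error is at most \<open>2 * \<Omega> * \<sigma> ^ I\<close> from the gap
      plus \<open>\<Omega> * \<sigma> ^ I\<close> from the barrier, \<open>I\<close> being the
      number of the last call: together at most \<open>3 * \<epsilon> / 4\<close>.\<close>
    have "\<nu> / t = \<Omega> * \<sigma> ^ ?I \<epsilon>" using \<nu>_pos' \<Omega>_pos \<sigma> by (simp add: t_def)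
    moreover have "\<sigma> ^ ?I \<epsilon> \<le> \<epsilon> / (4 * \<Omega>)"
      using num_stages_upper[OF \<sigma> \<epsilon>(1), of \<eta>0] \<Omega>_pos by (simp add: \<eta>0)
    then have "\<Omega> * \<sigma> ^ ?I \<epsilon> \<le> \<epsilon> / 4" using \<Omega>_pos by (simp add: field_simps)
    ultimately have le: "Gap F g (s \<epsilon>) t z + \<nu> / t \<le> \<epsilon>" using z(2) \<epsilon>(1) by simp
    have "g z - ereal \<epsilon> \<le> g y" if "y \<in> feasible X P K" for y
    proof -
      have "g z \<le> g y + ereal (Gap F g (s \<epsilon>) t z + \<nu> / t)"
        using that by (intro Gap_imp_near_minimal[OF s[OF \<epsilon>] t z(1)]) (auto simp: feasible_def)
      also have "\<dots> \<le> g y + ereal \<epsilon>" using le by (intro add_left_mono) simp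
      finally show ?thesis by (simp add: ereal_minus_le)
    qed
    then have "g z - ereal \<epsilon> \<le> Opt g X P K"
      unfolding Opt_def by (intro INF_greatest)
    moreover obtain r where "g z = ereal r" using g_eq[of z] z(1) by blast
    ultimately have "g z - Opt g X P K \<le> ereal \<epsilon>"
      by (cases "Opt g X P K") auto
    then show ?thesis
      using z(1) C_Q[OF z(1)] interior_subset[of "P -` K"] unfolding eps_solution_def z_def by blast
  qed
  have terminates: "homotopy_terminates F g (s \<epsilon>) \<sigma> x0 \<eta>0 t0 \<epsilon>" if \<epsilon>: "0 < \<epsilon>" "\<epsilon> < 1" for \<epsilon>
    unfolding homotopy_terminates_def t0 \<eta>0
  proof (intro allI impI)
    fix i
    show "case call_args F g (s \<epsilon>) \<sigma> x0 (2 * \<Omega>) (\<nu> / \<Omega>) i of (x, \<eta>, t) \<Rightarrow> cg_terminates F g (s \<epsilon>) x \<eta> t"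
      using calls[OF s[OF \<epsilon>], of i] by auto
  qed
  \<comment> \<open>\<open>A / (1 - \<sigma>\<^sup>2)\<close> comes from the geometric sum; the
    square comes from its last term, as the final power of \<open>\<sigma>\<close> is at least
    \<open>\<sigma> * \<epsilon> / (4 * \<Omega>)\<close>.\<close>
  define A' where "A' = A / (1 - \<sigma>\<^sup>2) * (4 * \<Omega> / \<sigma>)\<^sup>2"
  have \<sigma>2: "1 - \<sigma>\<^sup>2 > 0" using \<sigma> by (simp add: abs_square_less_1)
  have bound: "real (Compl F g (s \<epsilon>) \<sigma> x0 \<eta>0 t0 \<epsilon>) \<le> A' / \<epsilon>\<^sup>2"
    if \<epsilon>: "0 < \<epsilon>" "\<epsilon> < 1" "\<epsilon> \<le> 4 * \<Omega>" for \<epsilon>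
  proof -
    have "real (Compl F g (s \<epsilon>) \<sigma> x0 \<eta>0 t0 \<epsilon>) \<le> (\<Sum>i\<le>?I \<epsilon>. A / (\<sigma> ^ i)\<^sup>2)"
      unfolding Compl_def t0 \<eta>0 of_nat_sum
    proof (rule sum_mono)
      fix i
      show "real (case call_args F g (s \<epsilon>) \<sigma> x0 (2 * \<Omega>) (\<nu> / \<Omega>) i of (x, \<eta>, t) \<Rightarrow> cg_index F g (s \<epsilon>) x \<eta> t)
          \<le> A / (\<sigma> ^ i)\<^sup>2"
        using calls[OF s[OF \<epsilon>(1,2)], of i] by auto
    qed
    also have "\<dots> = A / (1 - \<sigma>\<^sup>2) * ((1 - \<sigma>\<^sup>2) * (\<Sum>i\<le>?I \<epsilon>. 1 / (\<sigma> ^ i)\<^sup>2))"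
      using \<sigma>2 by (simp add: sum_distrib_left)
    also have "\<dots> \<le> A / (1 - \<sigma>\<^sup>2) * (1 / (\<sigma> ^ ?I \<epsilon>)\<^sup>2)"
      using A \<sigma>2 \<sigma> by (intro mult_left_mono sum_inverse_powers_le) auto
    also have "\<dots> \<le> A / (1 - \<sigma>\<^sup>2) * (1 / (\<sigma> * \<epsilon> / (4 * \<Omega>))\<^sup>2)"
    proof (intro mult_left_mono divide_left_mono power_mono)
      show "\<sigma> * \<epsilon> / (4 * \<Omega>) \<le> \<sigma> ^ ?I \<epsilon>"
        using num_stages_lower[OF \<sigma> \<epsilon>(1), of \<eta>0] \<epsilon>(3) by (simp add: \<eta>0)
    qed (use A \<sigma>2 \<sigma> \<epsilon> \<Omega>_pos in auto)
    also have "\<dots> = A' / \<epsilon>\<^sup>2"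
      by (simp add: A'_def power_divide power_mult_distrib)
    finally show ?thesis .
  qed
  define V where "V = (\<lambda>\<epsilon>. 384 * \<Omega>\<^sup>2 * \<nu> / (\<epsilon>\<^sup>2 * (1 - \<sigma>\<^sup>2)) +
      \<Omega> * ln (21.2 * \<nu> * (1 + 2 / \<epsilon> * \<Omega>)) * (21.2 * \<nu> / \<epsilon>) * ((2 - \<sigma>) / (1 - \<sigma>)))"
  define B where "B = 384 * \<Omega>\<^sup>2 * \<nu> / (1 - \<sigma>\<^sup>2)"
  have B: "B > 0" using \<Omega>_pos \<nu>_pos' \<sigma>2 by (simp add: B_def)
  \<comment> \<open>The first summand of \<open>V\<close> carries the comparison. The second is
    nonnegative once the argument of the logarithm reaches 1, which
    \<open>\<epsilon> \<le> 42.4 * \<nu> * \<Omega>\<close> ensures.\<close>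
  have V: "B / \<epsilon>\<^sup>2 \<le> V \<epsilon>" if \<epsilon>: "0 < \<epsilon>" "\<epsilon> \<le> 42.4 * \<nu> * \<Omega>" for \<epsilon>
  proof -
    have "1 \<le> 21.2 * \<nu> * (2 / \<epsilon> * \<Omega>)" using \<epsilon> by (simp add: field_simps)
    also have "\<dots> \<le> 21.2 * \<nu> * (1 + 2 / \<epsilon> * \<Omega>)" using \<nu>_pos' by (intro mult_left_mono) auto
    finally have "ln (21.2 * \<nu> * (1 + 2 / \<epsilon> * \<Omega>)) \<ge> 0" by simp
    then have "0 \<le> \<Omega> * ln (21.2 * \<nu> * (1 + 2 / \<epsilon> * \<Omega>)) * (21.2 * \<nu> / \<epsilon>) * ((2 - \<sigma>) / (1 - \<sigma>))"
      using \<Omega>_pos \<nu>_pos' \<sigma> \<epsilon> by (intro mult_nonneg_nonneg) auto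
    then show ?thesis by (simp add: V_def B_def mult.commute)
  qed
  \<comment> \<open>The logarithmic exponent is 0: the count is at most a constant over
    \<open>\<epsilon>\<^sup>2\<close>, with the constant depending on the problem data,
    \<open>x0\<close> and \<open>\<sigma>\<close>.\<close>
  have "(\<lambda>\<epsilon>. real (Compl F g (s \<epsilon>) \<sigma> x0 \<eta>0 t0 \<epsilon>)) \<in> O[at_right 0](\<lambda>\<epsilon>. V \<epsilon> * ln (1 / \<epsilon>) ^ 0)"
  proof (rule bigoI)
    have "eventually (\<lambda>\<epsilon>::real. \<epsilon> \<in> {0<..<min 1 (min (4 * \<Omega>) (42.4 * \<nu> * \<Omega>))}) (at_right 0)"
      using \<Omega>_pos \<nu>_pos' by (intro eventually_at_right_real) simp
    then show "eventually (\<lambda>\<epsilon>. norm (real (Compl F g (s \<epsilon>) \<sigma> x0 \<eta>0 t0 \<epsilon>))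
        \<le> A' / B * norm (V \<epsilon> * ln (1 / \<epsilon>) ^ 0)) (at_right 0)"
    proof eventually_elim
      case (elim \<epsilon>)
      have A': "A' \<ge> 0" using A \<sigma>2 by (simp add: A'_def)
      have "real (Compl F g (s \<epsilon>) \<sigma> x0 \<eta>0 t0 \<epsilon>) \<le> A' / B * (B / \<epsilon>\<^sup>2)"
        using bound[of \<epsilon>] elim B by simp
      also have "\<dots> \<le> A' / B * V \<epsilon>"
        using V[of \<epsilon>] elim A' B by (intro mult_left_mono) auto
      also have "\<dots> \<le> A' / B * norm (V \<epsilon> * ln (1 / \<epsilon>) ^ 0)"
        using A' B by (intro mult_left_mono) auto
      finally show ?case by simp
    qed
  qed
  then have "soft_bigo (\<lambda>\<epsilon>. real (Compl F g (s \<epsilon>) \<sigma> x0 \<eta>0 t0 \<epsilon>)) V"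
    unfolding soft_bigo_def by blast
  with solution terminates show ?thesis unfolding V_def by blast
qed

end
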